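(* Let $U:\mathbb{R}^d\to\mathbb{R}$ be continuously differentiable, and let $L\ge 0$, $m>0$ be such that for all $x,y\in\mathbb{R}^d$, $\|\nabla U(x)-\nabla U(y)\|\le L\|x-y\|$ and $U(y)\ge U(x)+\langle\nabla U(x),y-x\rangle+(m/2)\|x-y\|^2$. Let $\gamma\in(0,1/(m+L)]$. Then $$W_2^2(\pi,\pi_\gamma)\le 2\kappa^{-1}L^2\gamma\left\{\kappa^{-1}+\gamma\right\}\left(2d+dL^2\gamma/m+dL^2\gamma^2/6\right).$$
   Context: Here $d\ge1$, $\kappa=2mL/(m+L)$, and $\pi$ is the probability measure on $\mathbb{R}^d$ with density proportional to $e^{-U}$. For $\gamma>0$, $R_\gamma$ is the Markov kernel on $\mathbb{R}^d$ such that $R_\gamma(x,\cdot)$ is the Gaussian distribution with mean $x-\gamma\nabla U(x)$ and covariance matrix $2\gamma I_d$; for $\gamma\le 2/(m+L)$, $R_\gamma$ has a unique stationary distribution, denoted $\pi_\gamma$. $W_2$ is the Wasserstein distance of order $2$ associated with the Euclidean distance. *)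

theory Defs
  imports "HOL-Probability.Probability"
begin

definition gibbs_measure :: "(real ^ 'n \<Rightarrow> real) \<Rightarrow> (real ^ 'n) measure" where
  "gibbs_measure U =
     density lborel (\<lambda>x. ennreal (exp (- U x) / (\<integral>y. exp (- U y) \<partial>lborel)))"

text \<open>The normal distribution with mean \<open>a\<close> and covariance matrix \<open>v I\<close>; the library's
  \<^const>\<open>normal_density\<close> takes the standard deviation.\<close>

definition isotropic_gaussian :: "real ^ 'n \<Rightarrow> real \<Rightarrow> (real ^ 'n) measure" where
  "isotropic_gaussian a v =
     density lborel (\<lambda>y. ennreal (\<Prod>i\<in>UNIV. normal_density (a $ i) (sqrt v) (y $ i)))"

definition euler_kernel ::
    "(real ^ 'n \<Rightarrow> real ^ 'n) \<Rightarrow> real \<Rightarrow> real ^ 'n \<Rightarrow> (real ^ 'n) measure" where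
  "euler_kernel gradU \<gamma> x = isotropic_gaussian (x - \<gamma> *\<^sub>R gradU x) (2 * \<gamma>)"

definition stationary_distribution ::
    "('a::topological_space \<Rightarrow> 'a measure) \<Rightarrow> 'a measure \<Rightarrow> bool" where
  "stationary_distribution K \<mu> \<longleftrightarrow>
     prob_space \<mu> \<and> sets \<mu> = sets borel \<and>
     (\<forall>A\<in>sets borel. (\<integral>\<^sup>+x. emeasure (K x) A \<partial>\<mu>) = emeasure \<mu> A)"

definition couplings ::
    "'a::topological_space measure \<Rightarrow> 'a measure \<Rightarrow> ('a \<times> 'a) measure set" where
  "couplings \<mu> \<nu> =
     {\<zeta>. sets \<zeta> = sets (borel \<Otimes>\<^sub>M borel) \<and> distr \<zeta> borel fst = \<mu> \<and> distr \<zeta> borel snd = \<nu>}"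

definition ennreal_sqrt :: "ennreal \<Rightarrow> ennreal" where
  "ennreal_sqrt x = (if x = \<infinity> then \<infinity> else ennreal (sqrt (enn2real x)))"

text \<open>The Wasserstein distance is extended-valued, so that an upper bound on it by a finite
  number also asserts that it is finite.\<close>

definition wasserstein2 :: "'a::metric_space measure \<Rightarrow> 'a measure \<Rightarrow> ennreal" where
  "wasserstein2 \<mu> \<nu> =
     ennreal_sqrt (INF \<zeta>\<in>couplings \<mu> \<nu>. \<integral>\<^sup>+z. ennreal ((dist (fst z) (snd z))\<^sup>2) \<partial>\<zeta>)"

end

theory Submission
  imports Defs
begin

text \<open>
  The Langevin diffusion is replaced by the Metropolis-adjusted Langevin chain with a small step
  \<open>h\<close>, for which \<open>\<pi>\<close> is exactly stationary. Starting from a coupling of \<open>\<pi>\<close> and \<open>\<pi>\<^sub>\<gamma>\<close>, run \<open>N\<close> steps of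
  this chain, with \<open>N h = \<gamma>\<close>, and one Euler step of length \<open>\<gamma>\<close> driven by the sum of the same Gaussian
  increments. The result is again a coupling of \<open>\<pi>\<close> and \<open>\<pi>\<^sub>\<gamma>\<close>. The rejections displace the chain by
  \<open>O(\<surd>h)\<close> in \<open>L\<^sup>2\<close>, the Euler drift contracts distances by the factor \<open>1 - \<gamma> m\<close>, and replacing \<open>\<nabla>U\<close> along
  the chain by its initial value costs at most
  \<open>L (\<gamma>\<^sup>2 \<surd>(L d) / 2 + \<gamma> \<surd>(\<gamma> d))\<close>, because \<open>E\<^sub>\<pi> |\<nabla>U|\<^sup>2 \<le> L d\<close>. Taking \<open>h \<rightarrow> 0\<close> and the infimum over
  couplings gives
  \<open>\<gamma> m W\<^sub>2(\<pi>, \<pi>\<^sub>\<gamma>) \<le> L (\<gamma>\<^sup>2 \<surd>(L d) / 2 + \<gamma> \<surd>(\<gamma> d))\<close>, which implies the claim by the inequality of arithmetic and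
  geometric means.
\<close>

text \<open>The chain stands in for the diffusion because detailed balance alone makes it
  stationary: no stochastic differential equation has to be solved, and rejection is the only price.
  That price is the delicate point. A step rejects, with probability O(h), a move of length O(sqrt
  h), so its displacement has L2 norm O(h); adding such norms over \<gamma> / h steps leaves a
  quantity that does not vanish with h. The squared norm of the accumulated displacement is tracked
  instead: there the conditional mean and the second moment both contribute O(h^2) per step, up to a
  factor 1 + h, hence O(h) in total.

  One coupled step turns a coupling of cost q^2 into one of cost ((1 - \<gamma> m) q + c)^2 with c
  fixed, in the limit of small h. The inequality D \<le> (1 - \<gamma> m) D + c that this gives for
  the infimum is empty if D is infinite, so the second moment of the stationary law must first be
  shown finite, from stationarity alone.

  The gradient is only Lipschitz. Convexity inequalities at both endpoints and difference quotients
  take the place of second derivatives.\<close>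

subsection \<open>Square-integrable maps\<close>

text \<open>A bound on the L2 norm through the nonnegative integral, so that no integrability has to
  be carried along. The sign condition makes the square monotone in \<open>c\<close>, on which
  weakening and adding bounds rely.\<close>

definition l2_bounded :: "'a measure \<Rightarrow> ('a \<Rightarrow> 'b::real_normed_vector) \<Rightarrow> real \<Rightarrow> bool" where
  "l2_bounded M f c \<longleftrightarrow> c \<ge> 0 \<and> (\<integral>\<^sup>+x. ennreal ((norm (f x))\<^sup>2) \<partial>M) \<le> ennreal (c\<^sup>2)"

lemma l2_boundedD_nonneg: "l2_bounded M f c \<Longrightarrow> c \<ge> 0"
  by (simp add: l2_bounded_def)

lemma l2_bounded_mono:
  assumes "l2_bounded M f c" "c \<le> c'"
  shows "l2_bounded M f c'"
proof -
  have "ennreal (c\<^sup>2) \<le> ennreal (c'\<^sup>2)"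
    using assms by (intro ennreal_leI power_mono) (auto simp: l2_bounded_def)
  then show ?thesis
    using assms unfolding l2_bounded_def by (meson order_trans)
qed

lemma l2_bounded_mono_norm:
  assumes "l2_bounded M f c" "\<And>x. norm (g x) \<le> norm (f x)"
  shows "l2_bounded M g c"
proof -
  have "(\<integral>\<^sup>+x. ennreal ((norm (g x))\<^sup>2) \<partial>M) \<le> (\<integral>\<^sup>+x. ennreal ((norm (f x))\<^sup>2) \<partial>M)"
    using assms(2) by (intro nn_integral_mono ennreal_leI power_mono) auto
  then show ?thesis
    using assms(1) unfolding l2_bounded_def by (meson order_trans)
qed

lemma l2_bounded_scaleR:
  assumes "l2_bounded M f c" "a \<ge> 0" and [measurable]: "f \<in> borel_measurable M"
  shows "l2_bounded M (\<lambda>x. a *\<^sub>R f x) (a * c)"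
proof -
  have "(\<integral>\<^sup>+x. ennreal ((norm (a *\<^sub>R f x))\<^sup>2) \<partial>M)
      = (\<integral>\<^sup>+x. ennreal (a\<^sup>2) * ennreal ((norm (f x))\<^sup>2) \<partial>M)"
    by (simp add: power_mult_distrib ennreal_mult)
  also have "\<dots> = ennreal (a\<^sup>2) * (\<integral>\<^sup>+x. ennreal ((norm (f x))\<^sup>2) \<partial>M)"
    by (rule nn_integral_cmult) measurable
  also have "\<dots> \<le> ennreal (a\<^sup>2) * ennreal (c\<^sup>2)"
    using assms by (intro mult_left_mono) (auto simp: l2_bounded_def)
  finally show ?thesis
    using assms by (simp add: l2_bounded_def power_mult_distrib ennreal_mult)
qed

lemma l2_bounded_lipschitz:
  assumes "l2_bounded M f c" "a \<ge> 0" "\<And>x. norm (g x) \<le> a * norm (f x)"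
    and "f \<in> borel_measurable M"
  shows "l2_bounded M g (a * c)"
  by (rule l2_bounded_mono_norm[OF l2_bounded_scaleR[OF assms(1,2,4)]]) (use assms in auto)

lemma l2_bounded_minus: "l2_bounded M f c \<Longrightarrow> l2_bounded M (\<lambda>x. - f x) c"
  by (simp add: l2_bounded_def)

text \<open>Minkowski's inequality from a weighted Young inequality. The weights
  \<open>(a + b) / a\<close> and \<open>(a + b) / b\<close> are those for which the bounds
  \<open>a\<^sup>2\<close> and \<open>b\<^sup>2\<close> add up to exactly
  \<open>(a + b)\<^sup>2\<close>.\<close>

lemma l2_bounded_add_pos:
  assumes "l2_bounded M f a" "l2_bounded M g b" "a > 0" "b > 0"
    and [measurable]: "f \<in> borel_measurable M" "g \<in> borel_measurable M"
  shows "l2_bounded M (\<lambda>x. f x + g x) (a + b)"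
proof -
  have pointwise: "(norm (f x + g x))\<^sup>2 \<le> (a + b) / a * (norm (f x))\<^sup>2 + (a + b) / b * (norm (g x))\<^sup>2"
    for x
  proof -
    let ?u = "norm (f x)" and ?v = "norm (g x)"
    have "(norm (f x + g x))\<^sup>2 \<le> (?u + ?v)\<^sup>2"
      by (intro power_mono norm_triangle_ineq) auto
    moreover have "(a + b) / a * ?u\<^sup>2 + (a + b) / b * ?v\<^sup>2 - (?u + ?v)\<^sup>2 = (b * ?u - a * ?v)\<^sup>2 / (a * b)"
      using assms(3,4) by (simp add: field_simps power2_eq_square)
    moreover have "(b * ?u - a * ?v)\<^sup>2 / (a * b) \<ge> 0"
      using assms(3,4) by simp
    ultimately show ?thesis by linarith
  qed
  have "(\<integral>\<^sup>+x. ennreal ((norm (f x + g x))\<^sup>2) \<partial>M) \<le>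
    (\<integral>\<^sup>+x. ennreal ((a + b) / a) * ennreal ((norm (f x))\<^sup>2)
           + ennreal ((a + b) / b) * ennreal ((norm (g x))\<^sup>2) \<partial>M)"
    using pointwise assms(3,4)
    by (intro nn_integral_mono) (auto simp flip: ennreal_mult ennreal_plus intro!: ennreal_leI)
  also have "\<dots> = ennreal ((a + b) / a) * (\<integral>\<^sup>+x. ennreal ((norm (f x))\<^sup>2) \<partial>M)
           + ennreal ((a + b) / b) * (\<integral>\<^sup>+x. ennreal ((norm (g x))\<^sup>2) \<partial>M)"
    by (subst nn_integral_add) (auto simp: nn_integral_cmult)
  also have "\<dots> \<le> ennreal ((a + b) / a) * ennreal (a\<^sup>2) + ennreal ((a + b) / b) * ennreal (b\<^sup>2)"
    using assms by (intro add_mono mult_left_mono) (auto simp: l2_bounded_def)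
  also have "\<dots> = ennreal ((a + b)\<^sup>2)"
    using assms(3,4)
    by (auto simp flip: ennreal_mult ennreal_plus intro!: arg_cong[where f=ennreal])
       (simp add: field_simps power2_eq_square)
  finally show ?thesis
    using assms by (simp add: l2_bounded_def)
qed

lemma l2_bounded_add:
  assumes "l2_bounded M f a" "l2_bounded M g b"
    and [measurable]: "f \<in> borel_measurable M" "g \<in> borel_measurable M"
  shows "l2_bounded M (\<lambda>x. f x + g x) (a + b)"
proof -
  have ab: "a \<ge> 0" "b \<ge> 0"
    using assms(1,2) by (auto simp: l2_bounded_def)
  \<comment> \<open>A bound may be zero, where the weights of \<open>l2_bounded_add_pos\<close>
    degenerate; both bounds are enlarged by \<open>e\<close>, which then tends to zero.\<close>
  have "l2_bounded M (\<lambda>x. f x + g x) ((a + e) + (b + e))" if "e > 0" for e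
    using that ab assms
    by (intro l2_bounded_add_pos) (auto intro: l2_bounded_mono)
  then have bound: "(\<integral>\<^sup>+x. ennreal ((norm (f x + g x))\<^sup>2) \<partial>M) \<le> ennreal ((a + b + 2 * e)\<^sup>2)"
    if "e > 0" for e
    using that by (simp add: l2_bounded_def algebra_simps)
  have "((\<lambda>e. ennreal ((a + b + 2 * e)\<^sup>2)) \<longlongrightarrow> ennreal ((a + b + 2 * 0)\<^sup>2)) (at_right 0)"
    by (intro tendsto_intros)
  moreover have "\<forall>\<^sub>F e in at_right 0.
      (\<integral>\<^sup>+x. ennreal ((norm (f x + g x))\<^sup>2) \<partial>M) \<le> ennreal ((a + b + 2 * e)\<^sup>2)"
    using bound by (auto simp: eventually_at_filter)
  ultimately have "(\<integral>\<^sup>+x. ennreal ((norm (f x + g x))\<^sup>2) \<partial>M) \<le> ennreal ((a + b + 2 * 0)\<^sup>2)"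
    by (rule tendsto_lowerbound) simp
  then show ?thesis
    using ab by (simp add: l2_bounded_def)
qed

lemma l2_bounded_diff:
  fixes f g :: "'a \<Rightarrow> 'b::{real_normed_vector, second_countable_topology}"
  assumes "l2_bounded M f a" "l2_bounded M g b"
    and "f \<in> borel_measurable M" "g \<in> borel_measurable M"
  shows "l2_bounded M (\<lambda>x. f x - g x) (a + b)"
  using l2_bounded_add[OF assms(1) l2_bounded_minus[OF assms(2)]] assms(3,4)
  by (simp add: borel_measurable_uminus)

lemma nn_integral_distr_pair:
  assumes "sigma_finite_measure N"
    and F [measurable]: "F \<in> measurable (M \<Otimes>\<^sub>M N) K" and [measurable]: "\<phi> \<in> borel_measurable K"
  shows "(\<integral>\<^sup>+y. \<phi> y \<partial>distr (M \<Otimes>\<^sub>M N) K F) = (\<integral>\<^sup>+x. \<integral>\<^sup>+\<omega>. \<phi> (F (x, \<omega>)) \<partial>N \<partial>M)"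
proof -
  interpret sigma_finite_measure N by fact
  show ?thesis
    by (simp add: nn_integral_distr nn_integral_fst[symmetric])
qed

subsection \<open>Isotropic Gaussian measures\<close>

lemma nn_integral_lborel_vec:
  fixes f :: "'n::finite \<Rightarrow> real \<Rightarrow> ennreal"
  assumes [measurable]: "\<And>i. f i \<in> borel_measurable borel"
  shows "(\<integral>\<^sup>+x. (\<Prod>i\<in>UNIV. f i (x $ i)) \<partial>(lborel :: (real ^ 'n) measure)) = (\<Prod>i\<in>UNIV. \<integral>\<^sup>+t. f i t \<partial>lborel)"
proof -
  have Basis: "(Basis :: (real ^ 'n) set) = (\<lambda>i. axis i 1) ` UNIV"
    by (auto simp: Basis_vec_def)
  have inj: "inj (\<lambda>i. axis i 1 :: real ^ 'n)"
    by (auto simp: inj_on_def axis_eq_axis)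
  have "(\<integral>\<^sup>+x. (\<Prod>i\<in>UNIV. f i (x $ i)) \<partial>(lborel :: (real ^ 'n) measure))
      = (\<integral>\<^sup>+x. (\<Prod>b\<in>Basis. f (axis_index b) (x \<bullet> b)) \<partial>(lborel :: (real ^ 'n) measure))"
    by (intro nn_integral_cong) (simp add: Basis prod.reindex[OF inj] inner_axis)
  also have "\<dots> = (\<Prod>b\<in>(Basis :: (real ^ 'n) set). \<integral>\<^sup>+t. f (axis_index b) t \<partial>lborel)"
    by (rule nn_integral_lborel_prod) auto
  also have "\<dots> = (\<Prod>i\<in>UNIV. \<integral>\<^sup>+t. f i t \<partial>lborel)"
    by (simp add: Basis prod.reindex[OF inj])
  finally show ?thesis .
qed

lemma nn_integral_lborel_affine:
  fixes f :: "'a::euclidean_space \<Rightarrow> ennreal"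
  assumes [measurable]: "f \<in> borel_measurable borel" and "c > 0"
  shows "(\<integral>\<^sup>+y. f y \<partial>lborel) = (\<integral>\<^sup>+z. ennreal (c ^ DIM('a)) * f (a + c *\<^sub>R z) \<partial>lborel)"
proof -
  have "(\<integral>\<^sup>+y. f y \<partial>lborel)
      = (\<integral>\<^sup>+y. f y \<partial>density (distr lborel borel (\<lambda>z. a + c *\<^sub>R z)) (\<lambda>_. ennreal (\<bar>c\<bar> ^ DIM('a))))"
    using lborel_affine[of c a] assms(2) by simp
  also have "\<dots> = (\<integral>\<^sup>+z. ennreal (c ^ DIM('a)) * f (a + c *\<^sub>R z) \<partial>lborel)"
    using assms(2) by (simp add: nn_integral_density nn_integral_distr)
  finally show ?thesis .
qed

lemma sets_isotropic_gaussian [simp, measurable_cong]: "sets (isotropic_gaussian a v) = sets borel"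
  by (simp add: isotropic_gaussian_def)

lemma space_isotropic_gaussian [simp]: "space (isotropic_gaussian a v) = UNIV"
  by (simp add: isotropic_gaussian_def)

lemma borel_measurable_gaussian_density [measurable]:
  "(\<lambda>y::real ^ 'n. \<Prod>i\<in>UNIV. normal_density (a $ i) s (y $ i)) \<in> borel_measurable borel"
  by measurable

lemma nn_integral_isotropic_gaussian:
  fixes a :: "real ^ 'n"
  assumes [measurable]: "f \<in> borel_measurable borel"
  shows "(\<integral>\<^sup>+y. f y \<partial>isotropic_gaussian a v)
    = (\<integral>\<^sup>+y. ennreal (\<Prod>i\<in>UNIV. normal_density (a $ i) (sqrt v) (y $ i)) * f y \<partial>lborel)"
  unfolding isotropic_gaussian_def by (subst nn_integral_density) auto

lemma nn_integral_normal_density: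
  "\<sigma> > 0 \<Longrightarrow> (\<integral>\<^sup>+t. ennreal (normal_density \<mu> \<sigma> t) \<partial>lborel) = 1"
  by (subst nn_integral_eq_integral) auto

lemma prob_space_isotropic_gaussian:
  assumes "v > 0"
  shows "prob_space (isotropic_gaussian a v)"
proof
  have "emeasure (isotropic_gaussian a v) (space (isotropic_gaussian a v))
      = (\<integral>\<^sup>+y. (\<Prod>i\<in>UNIV. ennreal (normal_density (a $ i) (sqrt v) (y $ i))) \<partial>lborel)"
    by (simp add: isotropic_gaussian_def emeasure_density prod_ennreal)
  also have "\<dots> = 1"
    using assms by (subst nn_integral_lborel_vec) (auto simp: nn_integral_normal_density)
  finally show "emeasure (isotropic_gaussian a v) (space (isotropic_gaussian a v)) = 1" .
qed

lemma isotropic_gaussian_affine: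
  fixes a :: "real ^ 'n"
  assumes "v > 0" "c > 0"
  shows "distr (isotropic_gaussian 0 v) borel (\<lambda>z. a + c *\<^sub>R z) = isotropic_gaussian a (c\<^sup>2 * v)"
proof (rule measure_eqI)
  fix A assume "A \<in> sets (distr (isotropic_gaussian 0 v) borel (\<lambda>z. a + c *\<^sub>R z))"
  then have A [measurable]: "A \<in> sets borel" by simp
  have density: "c ^ CARD('n) * (\<Prod>i\<in>UNIV. normal_density (a $ i) (sqrt (c\<^sup>2 * v)) ((a + c *\<^sub>R z) $ i))
     = (\<Prod>i\<in>UNIV. normal_density (0 $ i) (sqrt v) (z $ i))" for z :: "real ^ 'n"
  proof -
    have "c * normal_density m (sqrt (c\<^sup>2 * v)) (m + c * t) = normal_density 0 (sqrt v) t" for m t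
      using assms by (simp add: normal_density_def real_sqrt_mult power_mult_distrib)
    then show ?thesis
      by (simp flip: prod.distrib prod_constant)
  qed
  have "emeasure (isotropic_gaussian a (c\<^sup>2 * v)) A
      = (\<integral>\<^sup>+y. ennreal (\<Prod>i\<in>UNIV. normal_density (a $ i) (sqrt (c\<^sup>2 * v)) (y $ i)) * indicator A y \<partial>lborel)"
    unfolding isotropic_gaussian_def by (subst emeasure_density) auto
  also have "\<dots> = (\<integral>\<^sup>+z. ennreal (c ^ CARD('n)) * (ennreal (\<Prod>i\<in>UNIV. normal_density (a $ i) (sqrt (c\<^sup>2 * v)) ((a + c *\<^sub>R z) $ i))
       * indicator A (a + c *\<^sub>R z)) \<partial>lborel)"
    using assms(2) by (subst nn_integral_lborel_affine[of _ c a]) auto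
  also have "\<dots> = (\<integral>\<^sup>+z. ennreal (\<Prod>i\<in>UNIV. normal_density (0 $ i) (sqrt v) (z $ i))
       * indicator A (a + c *\<^sub>R z) \<partial>lborel)"
    using assms by (subst density[symmetric]) (simp add: ennreal_mult prod_nonneg mult.assoc)
  also have "\<dots> = (\<integral>\<^sup>+z. indicator A (a + c *\<^sub>R z) \<partial>isotropic_gaussian 0 v)"
    by (subst nn_integral_isotropic_gaussian) auto
  also have "\<dots> = (\<integral>\<^sup>+z. indicator A z \<partial>distr (isotropic_gaussian 0 v) borel (\<lambda>z. a + c *\<^sub>R z))"
    by (subst nn_integral_distr) auto
  finally show "emeasure (distr (isotropic_gaussian 0 v) borel (\<lambda>z. a + c *\<^sub>R z)) A
      = emeasure (isotropic_gaussian a (c\<^sup>2 * v)) A"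
    by simp
qed simp

text \<open>The convolution integral factorises over the coordinates, so the one-dimensional
  convolution of normal densities suffices. This turns a sum of small increments into a single Euler
  increment.\<close>

lemma nn_integral_isotropic_gaussian_add:
  fixes \<phi> :: "real ^ 'n \<Rightarrow> ennreal"
  assumes "v > 0" "w > 0" and [measurable]: "\<phi> \<in> borel_measurable borel"
  shows "(\<integral>\<^sup>+s. \<integral>\<^sup>+z. \<phi> (s + z) \<partial>isotropic_gaussian 0 w \<partial>isotropic_gaussian 0 v)
    = (\<integral>\<^sup>+x. \<phi> x \<partial>isotropic_gaussian 0 (v + w))"
proof -
  let ?p = "\<lambda>v (z::real ^ 'n). ennreal (\<Prod>i\<in>UNIV. normal_density (0 $ i) (sqrt v) (z $ i))"
  have [measurable]: "?p u \<in> borel_measurable borel" for u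
    by measurable
  have convolution: "(\<integral>\<^sup>+s. ?p w (x - s) * ?p v s \<partial>lborel) = ?p (v + w) x" for x :: "real ^ 'n"
  proof -
    have "(\<integral>\<^sup>+s. ?p w (x - s) * ?p v s \<partial>lborel)
        = (\<integral>\<^sup>+s. (\<Prod>i\<in>UNIV. ennreal (normal_density 0 (sqrt w) (x $ i - s $ i) * normal_density 0 (sqrt v) (s $ i))) \<partial>lborel)"
      by (simp add: prod_ennreal prod_nonneg prod.distrib flip: ennreal_mult)
    also have "\<dots> = (\<Prod>i\<in>UNIV. \<integral>\<^sup>+t. ennreal (normal_density 0 (sqrt w) (x $ i - t) * normal_density 0 (sqrt v) t) \<partial>lborel)"
      by (subst nn_integral_lborel_vec) auto
    also have "\<dots> = ?p (v + w) x"
      using assms(1,2) fun_cong[OF conv_normal_density_zero_mean[of "sqrt w" "sqrt v"]]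
      by (simp add: prod_ennreal add.commute)
    finally show ?thesis .
  qed
  have "(\<integral>\<^sup>+s. \<integral>\<^sup>+z. \<phi> (s + z) \<partial>isotropic_gaussian 0 w \<partial>isotropic_gaussian 0 v)
      = (\<integral>\<^sup>+s. ?p v s * (\<integral>\<^sup>+z. ?p w z * \<phi> (s + z) \<partial>lborel) \<partial>lborel)"
  proof -
    have [measurable]: "(\<lambda>s. \<integral>\<^sup>+z. ?p w z * \<phi> (s + z) \<partial>lborel) \<in> borel_measurable borel"
      by measurable
    have "(\<integral>\<^sup>+z. \<phi> (s + z) \<partial>isotropic_gaussian 0 w) = (\<integral>\<^sup>+z. ?p w z * \<phi> (s + z) \<partial>lborel)" for s
      by (rule nn_integral_isotropic_gaussian) measurable
    then show ?thesis
      by (simp only:) (rule nn_integral_isotropic_gaussian, measurable)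
  qed
  also have "\<dots> = (\<integral>\<^sup>+s. ?p v s * (\<integral>\<^sup>+x. ?p w (x - s) * \<phi> x \<partial>lborel) \<partial>lborel)"
  proof -
    have "(\<integral>\<^sup>+x. ?p w (x - s) * \<phi> x \<partial>lborel) = (\<integral>\<^sup>+z. ?p w z * \<phi> (s + z) \<partial>lborel)" for s
      by (subst nn_integral_lborel_affine[of _ 1 s]) simp_all
    then show ?thesis by simp
  qed
  also have "\<dots> = (\<integral>\<^sup>+s. \<integral>\<^sup>+x. \<phi> x * (?p w (x - s) * ?p v s) \<partial>lborel \<partial>lborel)"
    by (subst nn_integral_cmult[symmetric]) (auto simp: mult_ac)
  also have "\<dots> = (\<integral>\<^sup>+x. \<integral>\<^sup>+s. \<phi> x * (?p w (x - s) * ?p v s) \<partial>lborel \<partial>lborel)"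
    by (rule lborel_pair.Fubini') measurable
  also have "\<dots> = (\<integral>\<^sup>+x. ?p (v + w) x * \<phi> x \<partial>lborel)"
  proof -
    have "(\<integral>\<^sup>+s. \<phi> x * (?p w (x - s) * ?p v s) \<partial>lborel) = ?p (v + w) x * \<phi> x" for x
    proof -
      have "(\<integral>\<^sup>+s. \<phi> x * (?p w (x - s) * ?p v s) \<partial>lborel) = \<phi> x * (\<integral>\<^sup>+s. ?p w (x - s) * ?p v s \<partial>lborel)"
        by (rule nn_integral_cmult) measurable
      then show ?thesis
        by (simp only: convolution) (rule mult.commute)
    qed
    then show ?thesis by simp
  qed
  also have "\<dots> = (\<integral>\<^sup>+x. \<phi> x \<partial>isotropic_gaussian 0 (v + w))"
    by (simp add: nn_integral_isotropic_gaussian)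
  finally show ?thesis .
qed

lemma isotropic_gaussian_second_moment:
  assumes "v > 0"
  shows "(\<integral>\<^sup>+z. ennreal ((norm z)\<^sup>2) \<partial>(isotropic_gaussian 0 v :: (real ^ 'n) measure)) = ennreal (v * CARD('n))"
proof -
  let ?p = "\<lambda>t. ennreal (normal_density 0 (sqrt v) t)"
  have coordinate: "(\<integral>\<^sup>+z. (\<Prod>i\<in>UNIV. ?p (z $ i)) * ennreal ((z $ j)\<^sup>2) \<partial>(lborel :: (real ^ 'n) measure)) = ennreal v"
    for j
  proof -
    \<comment> \<open>Attaching the square to the factor with index \<open>j\<close> restores a
      product over the coordinates; the other factors integrate to one.\<close>
    have "(\<integral>\<^sup>+z. (\<Prod>i\<in>UNIV. ?p (z $ i)) * ennreal ((z $ j)\<^sup>2) \<partial>(lborel :: (real ^ 'n) measure))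
       = (\<integral>\<^sup>+z. (\<Prod>i\<in>UNIV. ?p (z $ i) * (if i = j then ennreal ((z $ i)\<^sup>2) else 1)) \<partial>(lborel :: (real ^ 'n) measure))"
      by (simp add: prod.distrib)
    also have "\<dots> = (\<Prod>i\<in>(UNIV::'n set). \<integral>\<^sup>+t. ?p t * (if i = j then ennreal (t\<^sup>2) else 1) \<partial>lborel)"
      by (subst nn_integral_lborel_vec) auto
    also have "\<dots> = (\<Prod>i\<in>(UNIV::'n set). if i = j then ennreal v else 1)"
    proof (intro prod.cong refl)
      fix i :: 'n
      have moment: "has_bochner_integral lborel (\<lambda>t. normal_density 0 (sqrt v) t * t\<^sup>2) v"
        using normal_moment_even[of "sqrt v" 0 1] assms by (simp add: power2_eq_square)
      have "(\<integral>\<^sup>+t. ?p t * ennreal (t\<^sup>2) \<partial>lborel) = ennreal v"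
        using moment by (subst ennreal_mult[symmetric], simp, simp)
          (subst nn_integral_eq_integral, auto simp: has_bochner_integral_iff)
      then show "(\<integral>\<^sup>+t. ?p t * (if i = j then ennreal (t\<^sup>2) else 1) \<partial>lborel) = (if i = j then ennreal v else 1)"
        using assms by (simp add: nn_integral_normal_density)
    qed
    finally show ?thesis by simp
  qed
  have "(\<integral>\<^sup>+z. ennreal ((norm z)\<^sup>2) \<partial>(isotropic_gaussian 0 v :: (real ^ 'n) measure))
     = (\<integral>\<^sup>+z. (\<Sum>j\<in>UNIV. (\<Prod>i\<in>UNIV. ?p (z $ i)) * ennreal ((z $ j)\<^sup>2)) \<partial>(lborel :: (real ^ 'n) measure))"
    by (simp add: nn_integral_isotropic_gaussian prod_ennreal norm_vec_def L2_set_def sum_nonneg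
        flip: sum_distrib_left)
  also have "\<dots> = (\<Sum>j\<in>(UNIV::'n set). ennreal v)"
    by (subst nn_integral_sum) (auto simp: coordinate)
  also have "\<dots> = ennreal (v * CARD('n))"
    using assms by (simp add: ennreal_mult' mult.commute ennreal_of_nat_eq_real_of_nat)
  finally show ?thesis .
qed

lemma nn_integral_exp_neg_square_finite:
  assumes "c > 0"
  shows "(\<integral>\<^sup>+x. ennreal (exp (- c * (norm x)\<^sup>2)) \<partial>(lborel :: (real ^ 'n) measure)) < \<infinity>"
proof -
  \<comment> \<open>The standard deviation whose centred normal density is proportional to
    \<open>exp (- c * t\<^sup>2)\<close>.\<close>
  define s where "s = sqrt (1 / (2 * c))"
  have s: "s > 0" "s\<^sup>2 = 1 / (2 * c)"
    using assms by (auto simp: s_def)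
  have "exp (- c * t\<^sup>2) = sqrt (2 * pi * s\<^sup>2) * normal_density 0 s t" for t
    using assms s by (simp add: normal_density_def field_simps)
  then have "(\<integral>\<^sup>+t. ennreal (exp (- c * t\<^sup>2)) \<partial>lborel)
      = (\<integral>\<^sup>+t. ennreal (sqrt (2 * pi * s\<^sup>2)) * ennreal (normal_density 0 s t) \<partial>lborel)"
    by (simp add: ennreal_mult)
  also have "\<dots> = ennreal (sqrt (2 * pi * s\<^sup>2))"
    using s by (simp add: nn_integral_cmult nn_integral_normal_density)
  finally have one_dim: "(\<integral>\<^sup>+t. ennreal (exp (- c * t\<^sup>2)) \<partial>lborel) = ennreal (sqrt (2 * pi * s\<^sup>2))" .
  have "(\<integral>\<^sup>+x. ennreal (exp (- c * (norm x)\<^sup>2)) \<partial>(lborel :: (real ^ 'n) measure))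
     = (\<integral>\<^sup>+x. (\<Prod>i\<in>UNIV. ennreal (exp (- c * (x $ i)\<^sup>2))) \<partial>(lborel :: (real ^ 'n) measure))"
    by (simp add: norm_vec_def L2_set_def sum_nonneg prod_ennreal sum_distrib_left exp_sum
        flip: sum_negf)
  also have "\<dots> < \<infinity>"
    by (subst nn_integral_lborel_vec) (use one_dim in \<open>auto simp: ennreal_power\<close>)
  finally show ?thesis .
qed

subsection \<open>Strongly convex potentials\<close>

locale strongly_convex_potential =
  fixes U :: "real ^ 'n \<Rightarrow> real" and gradU :: "real ^ 'n \<Rightarrow> real ^ 'n" and L m :: real
  assumes gderiv: "\<And>x. GDERIV U x :> gradU x"
    and m_pos: "m > 0"
    and lipschitz: "\<And>x y. norm (gradU x - gradU y) \<le> L * norm (x - y)"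
    and strongly_convex: "\<And>x y. U y \<ge> U x + gradU x \<bullet> (y - x) + m / 2 * (norm (x - y))\<^sup>2"
begin

lemma convex: "U y \<ge> U x + gradU x \<bullet> (y - x)"
proof -
  have "m / 2 * (norm (x - y))\<^sup>2 \<ge> 0"
    using m_pos by simp
  with strongly_convex[of x y] show ?thesis by linarith
qed

lemma strongly_monotone: "(gradU x - gradU y) \<bullet> (x - y) \<ge> m * (norm (x - y))\<^sup>2"
  using strongly_convex[of x y] strongly_convex[of y x]
  by (simp add: inner_diff_left inner_diff_right norm_minus_commute)

lemma m_le_L: "m \<le> L"
proof -
  \<comment> \<open>The index type is nonempty, so a unit vector exists; on it, monotonicity and the
    Lipschitz bound compare \<open>m\<close> with \<open>L\<close>.\<close>
  define e where "e = (axis undefined 1 :: real ^ 'n)"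
  have [simp]: "norm e = 1"
    by (simp add: e_def norm_axis_1)
  have "m \<le> (gradU e - gradU 0) \<bullet> e"
    using strongly_monotone[of e 0] by simp
  also have "\<dots> \<le> norm (gradU e - gradU 0)"
    using norm_cauchy_schwarz[of "gradU e - gradU 0" e] by simp
  also have "\<dots> \<le> L"
    using lipschitz[of e 0] by simp
  finally show ?thesis .
qed

lemma L_pos: "L > 0"
  using m_pos m_le_L by linarith

lemma continuous_gradU: "continuous_on A gradU"
proof -
  have "L-lipschitz_on A gradU"
    using lipschitz L_pos by (intro lipschitz_onI) (auto simp: dist_norm)
  then show ?thesis
    by (rule lipschitz_on_continuous_on)
qed

lemma continuous_U: "continuous_on A U"
proof (intro continuous_at_imp_continuous_on ballI)
  show "isCont U x" for x
    using gderiv[of x] has_derivative_continuous unfolding gderiv_def by blast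
qed

lemma measurable_U [measurable]: "U \<in> borel_measurable borel"
  by (rule borel_measurable_continuous_onI[OF continuous_U])

lemma measurable_gradU [measurable]: "gradU \<in> borel_measurable borel"
  by (rule borel_measurable_continuous_onI[OF continuous_gradU])

text \<open>Along the segment the difference of the two sides has a nonpositive derivative, by
  Cauchy-Schwarz and the Lipschitz bound, so monotonicity in one variable replaces an integral
  remainder.\<close>

lemma descent: "U y \<le> U x + gradU x \<bullet> (y - x) + L / 2 * (norm (y - x))\<^sup>2"
proof -
  define v where "v = y - x"
  define g where "g t = U (x + t *\<^sub>R v) - t * (gradU x \<bullet> v) - L / 2 * t\<^sup>2 * (norm v)\<^sup>2" for t
  have deriv: "(g has_real_derivative (gradU (x + t *\<^sub>R v) \<bullet> v - gradU x \<bullet> v - L * t * (norm v)\<^sup>2)) (at t)" for t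
  proof -
    have line: "((\<lambda>t. x + t *\<^sub>R v) has_derivative (\<lambda>h. h *\<^sub>R v)) (at t)"
      by (auto intro!: derivative_eq_intros)
    have "((\<lambda>t. U (x + t *\<^sub>R v)) has_derivative (\<lambda>h. (h *\<^sub>R v) \<bullet> gradU (x + t *\<^sub>R v))) (at t)"
      using has_derivative_compose[OF line gderiv[unfolded gderiv_def]] .
    then have "((\<lambda>t. U (x + t *\<^sub>R v)) has_real_derivative (gradU (x + t *\<^sub>R v) \<bullet> v)) (at t)"
      by (simp add: has_field_derivative_def inner_commute mult_commute_abs)
    then show ?thesis
      unfolding g_def by (auto intro!: derivative_eq_intros)
  qed
  have "g 1 \<le> g 0"
  proof (rule DERIV_nonpos_imp_nonincreasing[of 0 1 g])
    fix t :: real assume t: "0 \<le> t" "t \<le> 1"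
    have "gradU (x + t *\<^sub>R v) \<bullet> v - gradU x \<bullet> v \<le> norm (gradU (x + t *\<^sub>R v) - gradU x) * norm v"
      using norm_cauchy_schwarz by (simp flip: inner_diff_left)
    also have "\<dots> \<le> (L * (t * norm v)) * norm v"
      using lipschitz[of "x + t *\<^sub>R v" x] t by (intro mult_right_mono) auto
    finally show "\<exists>D. DERIV g t :> D \<and> D \<le> 0"
      using deriv[of t] by (auto simp: power2_eq_square mult_ac)
  qed simp
  then show ?thesis
    by (simp add: g_def v_def)
qed

text \<open>The gradient \<open>\<phi>'\<close> of the convex and \<open>(L - m)\<close>-smooth function
  \<open>\<phi> = U - m |\<cdot>|\<^sup>2 / 2\<close> is cocoercive. Stepping from \<open>y\<close> to \<open>y - \<gamma> (\<phi>' y - \<phi>' x)\<close>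
  rather than by the usual factor \<open>1 / (L - m)\<close> avoids a case distinction for \<open>L = m\<close>.\<close>
lemma gradient_step_contraction:
  assumes "\<gamma> > 0" "\<gamma> * (m + L) \<le> 1"
  shows "norm ((x - \<gamma> *\<^sub>R gradU x) - (y - \<gamma> *\<^sub>R gradU y)) \<le> (1 - \<gamma> * m) * norm (x - y)"
proof -
  define \<phi>' where "\<phi>' x = gradU x - m *\<^sub>R x" for x
  define \<phi> where "\<phi> x = U x - m / 2 * (x \<bullet> x)" for x
  have lower: "\<phi> y \<ge> \<phi> x + \<phi>' x \<bullet> (y - x)" for x y
    using strongly_convex[of x y] unfolding \<phi>_def \<phi>'_def power2_norm_eq_inner
    by (simp add: algebra_simps inner_commute)
  have upper: "\<phi> y \<le> \<phi> x + \<phi>' x \<bullet> (y - x) + (L - m) / 2 * ((y - x) \<bullet> (y - x))" for x y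
    using descent[of y x] unfolding \<phi>_def \<phi>'_def power2_norm_eq_inner
    by (simp add: algebra_simps inner_commute) argo
  have half: "\<phi> y - \<phi> x - \<phi>' x \<bullet> (y - x)
      \<ge> (\<gamma> - (L - m) * \<gamma>\<^sup>2 / 2) * ((\<phi>' x - \<phi>' y) \<bullet> (\<phi>' x - \<phi>' y))" for x y
  proof -
    define \<delta> where "\<delta> = \<phi>' y - \<phi>' x"
    \<comment> \<open>At the test point, the tangent of \<open>\<phi>\<close> at \<open>x\<close>
      from below is compared with the quadratic bound around \<open>y\<close> from above.\<close>
    have "\<phi> x + \<phi>' x \<bullet> (y - \<gamma> *\<^sub>R \<delta> - x)
        \<le> \<phi> y + \<phi>' y \<bullet> (- (\<gamma> *\<^sub>R \<delta>)) + (L - m) / 2 * ((\<gamma> *\<^sub>R \<delta>) \<bullet> (\<gamma> *\<^sub>R \<delta>))"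
      using lower[of x "y - \<gamma> *\<^sub>R \<delta>"] upper[of "y - \<gamma> *\<^sub>R \<delta>" y] by simp
    then have "\<phi> y - \<phi> x - \<phi>' x \<bullet> (y - x)
        \<ge> \<gamma> * ((\<phi>' y - \<phi>' x) \<bullet> \<delta>) - (L - m) / 2 * (\<gamma>\<^sup>2 * (\<delta> \<bullet> \<delta>))"
      by (simp add: algebra_simps power2_eq_square)
    moreover have "(\<phi>' x - \<phi>' y) \<bullet> (\<phi>' x - \<phi>' y) = \<delta> \<bullet> \<delta>"
      by (simp add: \<delta>_def algebra_simps)
    ultimately show ?thesis
      by (simp add: \<delta>_def algebra_simps) argo
  qed
  define p where "p = \<phi>' x - \<phi>' y"
  define D where "D = x - y"
  have cocoercive: "p \<bullet> D \<ge> (2 * \<gamma> - (L - m) * \<gamma>\<^sup>2) * (p \<bullet> p)"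
  proof -
    have "(\<phi>' y - \<phi>' x) \<bullet> (\<phi>' y - \<phi>' x) = p \<bullet> p"
      by (simp add: p_def algebra_simps)
    moreover have "- (\<phi>' x \<bullet> (y - x)) - \<phi>' y \<bullet> (x - y) = p \<bullet> D"
      by (simp add: p_def D_def algebra_simps)
    ultimately have "p \<bullet> D \<ge> 2 * ((\<gamma> - (L - m) * \<gamma>\<^sup>2 / 2) * (p \<bullet> p))"
      using half[of x y, folded p_def] half[of y x] by simp
    moreover have "2 * \<gamma> - (L - m) * \<gamma>\<^sup>2 = 2 * (\<gamma> - (L - m) * \<gamma>\<^sup>2 / 2)"
      by simp
    ultimately show ?thesis
      by (simp only: mult.assoc)
  qed
  \<comment> \<open>When the square is expanded, the cross term has to absorb
    \<open>\<gamma>\<^sup>2 * (p \<bullet> p)\<close>. By cocoercivity this follows from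
    \<open>2 * (1 - a) * (2 - b + a) \<ge> 1\<close>, for which the step size restriction supplies
    \<open>b \<le> 1 - a\<close> and, with \<open>a \<le> b\<close>, also
    \<open>a \<le> 1 / 2\<close>.\<close>
  define a b where "a = \<gamma> * m" and "b = \<gamma> * L"
  have ab: "a > 0" "a \<le> b" "a + b \<le> 1"
    using assms m_pos m_le_L by (auto simp: a_def b_def algebra_simps)
  have "2 * (1 - a) * (2 - b + a) \<ge> 2 * (1 - a) * (1 + 2 * a)"
    using ab by (intro mult_left_mono) auto
  moreover have "2 * (1 - a) * (1 + 2 * a) \<ge> 1"
  proof -
    have "a * (1 - 2 * a) \<ge> 0" using ab by simp
    then show ?thesis by (simp add: algebra_simps)
  qed
  ultimately have coeff: "2 * (1 - a) * (2 - b + a) \<ge> 1" by linarith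
  have "\<gamma>\<^sup>2 * (p \<bullet> p) \<le> \<gamma>\<^sup>2 * (2 * (1 - a) * (2 - b + a)) * (p \<bullet> p)"
    using mult_left_mono[OF coeff, of "\<gamma>\<^sup>2"] by (intro mult_right_mono) auto
  also have "\<dots> = 2 * \<gamma> * (1 - a) * ((2 * \<gamma> - (L - m) * \<gamma>\<^sup>2) * (p \<bullet> p))"
    by (simp add: a_def b_def power2_eq_square algebra_simps)
  also have "\<dots> \<le> 2 * \<gamma> * (1 - a) * (p \<bullet> D)"
    using ab assms by (intro mult_left_mono cocoercive) auto
  finally have *: "\<gamma>\<^sup>2 * (p \<bullet> p) \<le> 2 * \<gamma> * (1 - a) * (p \<bullet> D)" .
  have step: "(x - \<gamma> *\<^sub>R gradU x) - (y - \<gamma> *\<^sub>R gradU y) = (1 - a) *\<^sub>R D - \<gamma> *\<^sub>R p"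
    by (simp add: p_def D_def \<phi>'_def a_def algebra_simps)
  have "(norm ((1 - a) *\<^sub>R D - \<gamma> *\<^sub>R p))\<^sup>2
      = (1 - a)\<^sup>2 * (D \<bullet> D) - 2 * \<gamma> * (1 - a) * (p \<bullet> D) + \<gamma>\<^sup>2 * (p \<bullet> p)"
    unfolding power2_norm_eq_inner by (simp add: algebra_simps inner_commute power2_eq_square)
  also have "\<dots> \<le> ((1 - a) * norm D)\<^sup>2"
    using * by (simp add: power_mult_distrib power2_norm_eq_inner)
  finally have "norm ((1 - a) *\<^sub>R D - \<gamma> *\<^sub>R p) \<le> (1 - a) * norm D"
    by (rule power2_le_imp_le) (use ab in auto)
  then show ?thesis
    by (simp add: step D_def a_def)
qed

section \<open>Metropolis ratio and rejection probability of the Langevin proposal\<close>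

text \<open>The logarithm of the Metropolis ratio of the Langevin proposal
  \<open>y ~ N(x - h \<nabla>U(x), 2 h I)\<close>.\<close>
definition log_ratio :: "real \<Rightarrow> real ^ 'n \<Rightarrow> real ^ 'n \<Rightarrow> real" where
  "log_ratio h x y = U x - U y - (norm (x - (y - h *\<^sub>R gradU y)))\<^sup>2 / (4 * h)
     + (norm (y - (x - h *\<^sub>R gradU x)))\<^sup>2 / (4 * h)"

text \<open>The singular terms \<open>(norm (y - x))\<^sup>2 / (4 * h)\<close> cancel. What remains
  is the error of the trapezoidal rule for \<open>U\<close> and a term with a factor
  \<open>h\<close>, both small for \<open>y\<close> near \<open>x\<close>.\<close>

lemma log_ratio_eq:
  assumes "h > 0"
  shows "log_ratio h x y = U x - U y + (gradU x + gradU y) \<bullet> (y - x) / 2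
     + h / 4 * ((norm (gradU x))\<^sup>2 - (norm (gradU y))\<^sup>2)"
proof -
  have "(norm (y - (x - h *\<^sub>R gradU x)))\<^sup>2 - (norm (x - (y - h *\<^sub>R gradU y)))\<^sup>2
    = 4 * h * ((gradU x + gradU y) \<bullet> (y - x) / 2 + h / 4 * ((norm (gradU x))\<^sup>2 - (norm (gradU y))\<^sup>2))"
    unfolding power2_norm_eq_inner by (simp add: algebra_simps inner_commute power2_eq_square) argo
  then have "((norm (y - (x - h *\<^sub>R gradU x)))\<^sup>2 - (norm (x - (y - h *\<^sub>R gradU y)))\<^sup>2) / (4 * h)
    = (gradU x + gradU y) \<bullet> (y - x) / 2 + h / 4 * ((norm (gradU x))\<^sup>2 - (norm (gradU y))\<^sup>2)"
    using assms by simp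
  then show ?thesis
    unfolding log_ratio_def diff_divide_distrib by linarith
qed

text \<open>By convexity at both endpoints, \<open>U y - U x\<close> lies between
  \<open>gradU x \<bullet> (y - x)\<close> and \<open>gradU y \<bullet> (y - x)\<close>, and the
  trapezoidal rule is the midpoint of that interval. Its error is thus quadratic in the distance
  without any second derivative.\<close>

lemma abs_log_ratio_le:
  assumes "h > 0"
  shows "\<bar>log_ratio h x y\<bar> \<le> L / 2 * (norm (y - x))\<^sup>2
     + h / 4 * (L * norm (y - x)) * (2 * norm (gradU x) + L * norm (y - x))"
proof -
  let ?d = "norm (y - x)"
  have cs: "\<bar>(gradU y - gradU x) \<bullet> (y - x)\<bar> \<le> L * ?d\<^sup>2"
  proof -
    have "\<bar>(gradU y - gradU x) \<bullet> (y - x)\<bar> \<le> norm (gradU y - gradU x) * ?d"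
      by (rule Cauchy_Schwarz_ineq2)
    also have "\<dots> \<le> (L * ?d) * ?d"
      by (intro mult_right_mono lipschitz) auto
    finally show ?thesis by (simp add: power2_eq_square mult_ac)
  qed
  have 1: "\<bar>U x - U y + (gradU x + gradU y) \<bullet> (y - x) / 2\<bar> \<le> L / 2 * ?d\<^sup>2"
    using convex[of x y] convex[of y x] cs
    by (simp add: inner_diff_left inner_diff_right inner_add_left abs_le_iff) argo
  have 2: "\<bar>(norm (gradU x))\<^sup>2 - (norm (gradU y))\<^sup>2\<bar> \<le> (L * ?d) * (2 * norm (gradU x) + L * ?d)"
  proof -
    have lip: "norm (gradU y - gradU x) \<le> L * ?d"
      by (rule lipschitz)
    have "\<bar>(norm (gradU x))\<^sup>2 - (norm (gradU y))\<^sup>2\<bar>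
        = \<bar>norm (gradU x) - norm (gradU y)\<bar> * (norm (gradU x) + norm (gradU y))"
      by (simp add: square_diff_square_factored power2_eq_square abs_mult mult.commute)
    also have "\<dots> \<le> (L * ?d) * (2 * norm (gradU x) + L * ?d)"
      using lip norm_triangle_ineq3[of "gradU x" "gradU y"] norm_triangle_sub[of "gradU y" "gradU x"]
      by (intro mult_mono) (auto simp: norm_minus_commute)
    finally show ?thesis .
  qed
  have "\<bar>h / 4 * ((norm (gradU x))\<^sup>2 - (norm (gradU y))\<^sup>2)\<bar>
      \<le> h / 4 * ((L * ?d) * (2 * norm (gradU x) + L * ?d))"
    using 2 assms by (simp add: abs_mult)
  with 1 show ?thesis
    unfolding log_ratio_eq[OF assms] by (simp only: mult.assoc)
qed

definition accept :: "real \<Rightarrow> real ^ 'n \<Rightarrow> real ^ 'n \<Rightarrow> real" where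
  "accept h x y = min 1 (exp (log_ratio h x y))"

lemma accept_bounds: "accept h x y \<ge> 0" "accept h x y \<le> 1"
  by (auto simp: accept_def)

lemma reject_le: "1 - accept h x y \<le> \<bar>log_ratio h x y\<bar>"
  using exp_ge_add_one_self[of "log_ratio h x y"] unfolding accept_def by linarith

lemma measurable_log_ratio [measurable (raw)]:
  assumes [measurable]: "f \<in> borel_measurable M" "g \<in> borel_measurable M"
  shows "(\<lambda>\<omega>. log_ratio h (f \<omega>) (g \<omega>)) \<in> borel_measurable M"
  unfolding log_ratio_def by measurable

lemma measurable_accept [measurable (raw)]:
  assumes [measurable]: "f \<in> borel_measurable M" "g \<in> borel_measurable M"
  shows "(\<lambda>\<omega>. accept h (f \<omega>) (g \<omega>)) \<in> borel_measurable M"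
  unfolding accept_def by measurable

lemma norm_gradU_le: "norm (gradU x) \<le> norm (gradU 0) + L * norm x"
  using lipschitz[of x 0] norm_triangle_sub[of "gradU x" "gradU 0"] by simp

text \<open>The sum of the coefficients \<open>L / 2\<close>, \<open>L / 2\<close> and
  \<open>L\<^sup>2 / 4\<close> of the three parts into which \<open>rejection_bound\<close> splits
  the bound on the log ratio.\<close>

definition reject_const :: real where
  "reject_const = L + L\<^sup>2 / 4"

text \<open>With probability \<open>O(h)\<close> the proposal, which is at distance \<open>O(\<surd>h)\<close>, is rejected.\<close>
lemma
  fixes x z :: "real ^ 'n"
  assumes "0 < h" "h \<le> 1"
  defines "y \<equiv> x - h *\<^sub>R gradU x + sqrt (2 * h) *\<^sub>R z"
    and "w \<equiv> norm (gradU x) + 2 * norm z"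
  shows proposal_distance: "norm (y - x) \<le> sqrt h * w"
    and rejection_bound: "1 - accept h x y \<le> reject_const * h * w\<^sup>2"
proof -
  have w: "w \<ge> 0" "norm (gradU x) \<le> w"
    by (auto simp: w_def)
  \<comment> \<open>For \<open>h \<le> 1\<close> drift and noise are both at most on the scale
    \<open>sqrt h\<close>; the factor 2 in \<open>w\<close> is a generous
    \<open>sqrt 2\<close>.\<close>
  have h_le: "h \<le> sqrt h"
    using assms(1,2) by (intro real_le_rsqrt) (simp add: power2_eq_square mult_left_le)
  have sqrt2: "sqrt 2 \<le> 2"
    by (intro real_le_lsqrt) auto
  have "norm (y - x) \<le> h * norm (gradU x) + sqrt (2 * h) * norm z"
    using norm_triangle_ineq[of "- (h *\<^sub>R gradU x)" "sqrt (2 * h) *\<^sub>R z"] assms(1)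
    by (simp add: y_def)
  also have "\<dots> \<le> sqrt h * norm (gradU x) + sqrt h * (2 * norm z)"
    using h_le sqrt2 assms(1)
    by (intro add_mono mult_right_mono) (auto simp: real_sqrt_mult intro!: mult_right_mono)
  finally show dist: "norm (y - x) \<le> sqrt h * w"
    by (simp add: w_def algebra_simps)
  have sq: "(norm (y - x))\<^sup>2 \<le> h * w\<^sup>2"
    using power_mono[OF dist, of 2] assms(1) by (simp add: power_mult_distrib)
  have prod: "h * norm (gradU x) * norm (y - x) \<le> h * w\<^sup>2"
  proof -
    have "h * norm (gradU x) * norm (y - x) \<le> h * w * (1 * w)"
      using w assms(1,2) dist by (intro mult_mono order_trans[OF dist]) auto
    then show ?thesis by (simp add: power2_eq_square)
  qed
  have "h * (norm (y - x))\<^sup>2 \<le> 1 * (h * w\<^sup>2)"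
    using assms(1,2) sq by (intro mult_mono) auto
  then have "h * (norm (y - x))\<^sup>2 \<le> h * w\<^sup>2"
    by simp
  then have 3: "L\<^sup>2 / 4 * (h * (norm (y - x))\<^sup>2) \<le> L\<^sup>2 / 4 * (h * w\<^sup>2)"
    by (rule mult_left_mono) auto
  have 1: "L / 2 * (norm (y - x))\<^sup>2 \<le> L / 2 * (h * w\<^sup>2)"
    by (rule mult_left_mono) (use sq L_pos in auto)
  have 2: "L / 2 * (h * norm (gradU x) * norm (y - x)) \<le> L / 2 * (h * w\<^sup>2)"
    by (rule mult_left_mono) (use prod L_pos in auto)
  have "1 - accept h x y \<le> L / 2 * (norm (y - x))\<^sup>2
     + h / 4 * (L * norm (y - x)) * (2 * norm (gradU x) + L * norm (y - x))"
    using reject_le abs_log_ratio_le[OF assms(1)] by (rule order_trans)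
  also have "\<dots> = L / 2 * (norm (y - x))\<^sup>2 + L / 2 * (h * norm (gradU x) * norm (y - x))
     + L\<^sup>2 / 4 * (h * (norm (y - x))\<^sup>2)"
    by (simp add: algebra_simps power2_eq_square)
  also have "\<dots> \<le> L / 2 * (h * w\<^sup>2) + L / 2 * (h * w\<^sup>2) + L\<^sup>2 / 4 * (h * w\<^sup>2)"
    using 1 2 3 by linarith
  also have "\<dots> = reject_const * h * w\<^sup>2"
    by (simp add: reject_const_def algebra_simps)
  finally show "1 - accept h x y \<le> reject_const * h * w\<^sup>2" .
qed

end

subsection \<open>Moments of the Gibbs measure\<close>

text \<open>The inequality \<open>u \<le> exp u\<close> is cubed at
  \<open>u = c / 3 * (1 + r\<^sup>2)\<close>, and the factor 8 comes from
  \<open>(1 + r)\<^sup>2 \<le> 2 * (1 + r\<^sup>2)\<close>. Sixth powers are the highest that the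
  rejection estimate produces.\<close>

lemma power6_le_exp_square:
  fixes r :: real
  assumes "c > 0" "r \<ge> 0"
  shows "(1 + r) ^ 6 \<le> 8 * (3 / c) ^ 3 * exp c * exp (c * r\<^sup>2)"
proof -
  have "(1 + r)\<^sup>2 \<le> 2 * (1 + r\<^sup>2)"
    using zero_le_power2[of "1 - r"] by (simp add: power2_eq_square algebra_simps)
  then have "((1 + r)\<^sup>2) ^ 3 \<le> (2 * (1 + r\<^sup>2)) ^ 3"
    by (intro power_mono) auto
  then have 1: "(1 + r) ^ 6 \<le> 8 * (1 + r\<^sup>2) ^ 3"
    by (subst (asm) power_mult_distrib) (simp flip: power_mult)
  have "(c / 3 * (1 + r\<^sup>2)) ^ 3 \<le> exp (c / 3 * (1 + r\<^sup>2)) ^ 3"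
  proof (rule power_mono)
    show "c / 3 * (1 + r\<^sup>2) \<le> exp (c / 3 * (1 + r\<^sup>2))"
      using exp_ge_add_one_self[of "c / 3 * (1 + r\<^sup>2)"] by linarith
  qed (use assms in auto)
  also have "\<dots> = exp (of_nat 3 * (c / 3 * (1 + r\<^sup>2)))"
    by (rule exp_of_nat_mult[symmetric])
  also have "of_nat 3 * (c / 3 * (1 + r\<^sup>2)) = c + c * r\<^sup>2"
    by (simp add: algebra_simps)
  also have "exp (c + c * r\<^sup>2) = exp c * exp (c * r\<^sup>2)"
    by (rule exp_add)
  finally have "(3 / c) ^ 3 * (c / 3 * (1 + r\<^sup>2)) ^ 3 \<le> (3 / c) ^ 3 * (exp c * exp (c * r\<^sup>2))"
    using assms by (intro mult_left_mono) auto
  moreover have "(3 / c) ^ 3 * (c / 3 * (1 + r\<^sup>2)) ^ 3 = (1 + r\<^sup>2) ^ 3"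
    using assms by (simp add: power_mult_distrib power_divide)
  ultimately have "(1 + r\<^sup>2) ^ 3 \<le> (3 / c) ^ 3 * (exp c * exp (c * r\<^sup>2))"
    by (simp only:)
  with 1 show ?thesis by (simp add: mult_ac)
qed

text \<open>The quadratic Taylor polynomials at \<open>y\<close> and \<open>- y\<close> have the
  product \<open>1 + y ^ 4 / 4\<close>, which is at least one, so the lower Taylor bound for
  \<open>exp (- y)\<close> inverts to this upper bound.\<close>

lemma exp_neg_le_quadratic:
  fixes y :: real
  assumes "y \<le> 0"
  shows "exp y \<le> 1 + y + y\<^sup>2 / 2"
proof -
  have pos: "1 + y + y\<^sup>2 / 2 > 0"
  proof -
    have "1 + y + y\<^sup>2 / 2 = ((1 + y)\<^sup>2 + 1) / 2"
      by (simp add: power2_eq_square algebra_simps)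
    moreover have "((1 + y)\<^sup>2 + 1) / 2 > 0"
      by (simp add: add_nonneg_pos)
    ultimately show ?thesis
      by (simp only:)
  qed
  have "1 \<le> (1 + y + y\<^sup>2 / 2) * (1 - y + y\<^sup>2 / 2)"
  proof -
    have "(1 + y + y\<^sup>2 / 2) * (1 - y + y\<^sup>2 / 2) = 1 + (y\<^sup>2)\<^sup>2 / 4"
      by (simp add: power2_eq_square algebra_simps)
    then show ?thesis by simp
  qed
  also have "\<dots> \<le> (1 + y + y\<^sup>2 / 2) * exp (- y)"
    using exp_lower_Taylor_quadratic[of "- y"] assms pos by (intro mult_left_mono) auto
  finally show ?thesis
    by (simp add: exp_minus field_simps)
qed

lemma gaussian_power6_moment:
  "(\<integral>\<^sup>+z. ennreal ((1 + norm z) ^ 6) \<partial>(isotropic_gaussian 0 1 :: (real ^ 'n) measure)) < \<infinity>"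
proof -
  \<comment> \<open>The constant of \<open>power6_le_exp_square\<close> for the rate 1/4, which
    consumes half of the Gaussian decay rate 1/2.\<close>
  define c where "c = 8 * (3 / (1 / 4)) ^ 3 * exp (1 / 4 :: real)"
  define b where "b = (1 / sqrt (2 * pi)) ^ CARD('n)"
  have density: "(\<Prod>i\<in>UNIV. normal_density 0 1 (z $ i)) = b * exp (- (norm z)\<^sup>2 / 2)" for z :: "real ^ 'n"
    by (simp add: normal_density_def b_def prod.distrib norm_vec_def L2_set_def sum_nonneg exp_sum
        sum_divide_distrib power_divide prod_dividef flip: sum_negf)
  have bound: "b * exp (- (norm z)\<^sup>2 / 2) * (1 + norm z) ^ 6 \<le> b * c * exp (- (1 / 4) * (norm z)\<^sup>2)"
    for z :: "real ^ 'n"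
  proof -
    have "b * exp (- (norm z)\<^sup>2 / 2) * (1 + norm z) ^ 6
        \<le> b * exp (- (norm z)\<^sup>2 / 2) * (c * exp (1 / 4 * (norm z)\<^sup>2))"
      unfolding c_def by (intro mult_left_mono power6_le_exp_square) (auto simp: b_def)
    also have "\<dots> = b * c * exp (- (1 / 4) * (norm z)\<^sup>2)"
      by (simp flip: exp_add)
    finally show ?thesis .
  qed
  have bc: "b \<ge> 0" "c \<ge> 0"
    by (auto simp: b_def c_def)
  have "(\<integral>\<^sup>+z. ennreal ((1 + norm z) ^ 6) \<partial>(isotropic_gaussian 0 1 :: (real ^ 'n) measure))
      = (\<integral>\<^sup>+z. ennreal (b * exp (- (norm z)\<^sup>2 / 2) * (1 + norm z) ^ 6) \<partial>(lborel :: (real ^ 'n) measure))"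
    using bc by (subst nn_integral_isotropic_gaussian) (auto simp: density ennreal_mult)
  also have "\<dots> \<le> (\<integral>\<^sup>+z. ennreal (b * c * exp (- (1 / 4) * (norm z)\<^sup>2)) \<partial>(lborel :: (real ^ 'n) measure))"
    by (intro nn_integral_mono ennreal_leI bound)
  also have "\<dots> = (\<integral>\<^sup>+z. ennreal (b * c) * ennreal (exp (- (1 / 4) * (norm z)\<^sup>2)) \<partial>(lborel :: (real ^ 'n) measure))"
    using bc by (simp add: ennreal_mult)
  also have "\<dots> < \<infinity>"
    using nn_integral_exp_neg_square_finite[of "1 / 4", where 'n='n]
    by (simp add: nn_integral_cmult ennreal_mult_less_top)
  finally show ?thesis .
qed

context strongly_convex_potential
begin

text \<open>Strong convexity at the origin, with the linear term absorbed into half of the quadratic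
  one by completing a square; hence the rate drops from \<open>m / 2\<close> to
  \<open>m / 4\<close>.\<close>

lemma exp_neg_U_le: "exp (- U x) \<le> exp ((norm (gradU 0))\<^sup>2 / m - U 0) * exp (- (m / 4 * (norm x)\<^sup>2))"
proof -
  let ?g = "norm (gradU 0)" and ?r = "norm x"
  have "- (gradU 0 \<bullet> x) \<le> ?g * ?r"
    using Cauchy_Schwarz_ineq2[of "gradU 0" x] by linarith
  also have "\<dots> \<le> ?g\<^sup>2 / m + m / 4 * ?r\<^sup>2"
  proof -
    have "?g\<^sup>2 / m + m / 4 * ?r\<^sup>2 - ?g * ?r = (?g - m / 2 * ?r)\<^sup>2 / m"
      using m_pos by (simp add: power2_eq_square field_simps)
    moreover have "(?g - m / 2 * ?r)\<^sup>2 / m \<ge> 0"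
      using m_pos by simp
    ultimately show ?thesis by linarith
  qed
  finally have "- U x \<le> ?g\<^sup>2 / m - U 0 - m / 4 * ?r\<^sup>2"
    using strongly_convex[of 0 x] by simp
  then show ?thesis
    by (simp flip: exp_add)
qed

lemma nn_integral_power6_exp_neg_U: "(\<integral>\<^sup>+x. ennreal ((1 + norm x) ^ 6 * exp (- U x)) \<partial>lborel) < \<infinity>"
proof -
  define b where "b = exp ((norm (gradU 0))\<^sup>2 / m - U 0)"
  define c where "c = 8 * (3 / (m / 8)) ^ 3 * exp (m / 8)"
  have bc: "b > 0" "c > 0"
    using m_pos by (auto simp: b_def c_def)
  have "(1 + norm x) ^ 6 * exp (- U x) \<le> (b * c) * exp (- (m / 8) * (norm x)\<^sup>2)" for x
  proof -
    have "(1 + norm x) ^ 6 * exp (- U x) \<le> (c * exp (m / 8 * (norm x)\<^sup>2)) * (b * exp (- (m / 4 * (norm x)\<^sup>2)))"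
      unfolding b_def c_def using m_pos by (intro mult_mono power6_le_exp_square exp_neg_U_le) auto
    also have "\<dots> = (b * c) * exp (- (m / 8) * (norm x)\<^sup>2)"
      by (simp flip: exp_add)
    finally show ?thesis .
  qed
  then have "(\<integral>\<^sup>+x. ennreal ((1 + norm x) ^ 6 * exp (- U x)) \<partial>lborel)
      \<le> (\<integral>\<^sup>+x. ennreal (b * c) * ennreal (exp (- (m / 8) * (norm x)\<^sup>2)) \<partial>(lborel :: (real ^ 'n) measure))"
    using bc by (intro nn_integral_mono) (simp add: ennreal_leI flip: ennreal_mult)
  also have "\<dots> < \<infinity>"
    using nn_integral_exp_neg_square_finite[of "m / 8", where 'n='n] m_pos
    by (simp add: nn_integral_cmult ennreal_mult_less_top)
  finally show ?thesis .
qed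

lemma integrable_poly_exp_neg_U:
  fixes g :: "real ^ 'n \<Rightarrow> real"
  assumes [measurable]: "g \<in> borel_measurable borel" and "\<And>x. \<bar>g x\<bar> \<le> c * (1 + norm x) ^ 6"
  shows "integrable lborel (\<lambda>x. g x * exp (- U x))"
proof (rule Bochner_Integration.integrable_bound)
  show "integrable lborel (\<lambda>x. c * ((1 + norm x) ^ 6 * exp (- U x)))"
    using nn_integral_power6_exp_neg_U
    by (intro integrable_mult_right integrableI_nonneg) auto
  show "AE x in lborel. norm (g x * exp (- U x)) \<le> norm (c * ((1 + norm x) ^ 6 * exp (- U x)))"
  proof (rule AE_I2)
    fix x
    have "\<bar>g x\<bar> * exp (- U x) \<le> (c * (1 + norm x) ^ 6) * exp (- U x)"
      using assms(2) by (intro mult_right_mono) auto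
    also have "\<dots> \<le> norm (c * ((1 + norm x) ^ 6 * exp (- U x)))"
      unfolding mult.assoc real_norm_def by (rule abs_ge_self)
    finally show "norm (g x * exp (- U x)) \<le> norm (c * ((1 + norm x) ^ 6 * exp (- U x)))"
      by (simp add: abs_mult)
  qed
qed measurable

definition partition :: real where
  "partition = (\<integral>x. exp (- U x) \<partial>lborel)"

lemma integrable_exp_neg_U: "integrable lborel (\<lambda>x. exp (- U x))"
  using integrable_poly_exp_neg_U[of "\<lambda>_. 1" 1] by simp

text \<open>Integrability is essential: without it the Bochner integral would default to 0. Given
  it, a zero integral of the everywhere positive \<open>exp (- U x)\<close> would make Lebesgue
  measure null.\<close>

lemma partition_pos: "partition > 0"
proof -
  have "partition \<noteq> 0"
  proof
    assume "partition = 0"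
    then have "AE x in lborel. exp (- U x) = 0"
      using integral_nonneg_eq_0_iff_AE[OF integrable_exp_neg_U] by (simp add: partition_def)
    then have "AE x in (lborel :: (real ^ 'n) measure). False"
      by simp
    then have "emeasure lborel (UNIV :: (real ^ 'n) set) = 0"
      by (simp add: AE_iff_measurable[of UNIV])
    then show False by simp
  qed
  moreover have "partition \<ge> 0"
    unfolding partition_def by (rule integral_nonneg_AE) auto
  ultimately show ?thesis by simp
qed

lemma gibbs_eq: "gibbs_measure U = density lborel (\<lambda>x. ennreal (exp (- U x) / partition))"
  by (simp add: gibbs_measure_def partition_def)

lemma sets_gibbs [simp, measurable_cong]: "sets (gibbs_measure U) = sets borel"
  by (simp add: gibbs_eq)

lemma space_gibbs [simp]: "space (gibbs_measure U) = UNIV"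
  by (simp add: gibbs_eq)

lemma nn_integral_gibbs:
  assumes [measurable]: "\<phi> \<in> borel_measurable borel"
  shows "(\<integral>\<^sup>+x. \<phi> x \<partial>gibbs_measure U) = (\<integral>\<^sup>+x. ennreal (exp (- U x) / partition) * \<phi> x \<partial>lborel)"
  unfolding gibbs_eq by (subst nn_integral_density) auto

lemma prob_space_gibbs: "prob_space (gibbs_measure U)"
proof
  have "emeasure (gibbs_measure U) (space (gibbs_measure U)) = (\<integral>\<^sup>+x. ennreal (exp (- U x) / partition) \<partial>lborel)"
    by (simp add: gibbs_eq emeasure_density)
  also have "\<dots> = ennreal (\<integral>x. exp (- U x) / partition \<partial>lborel)"
    using partition_pos integrable_exp_neg_U by (intro nn_integral_eq_integral) auto
  also have "\<dots> = 1"
    using partition_pos integrable_exp_neg_U by (simp flip: partition_def)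
  finally show "emeasure (gibbs_measure U) (space (gibbs_measure U)) = 1" .
qed

lemma gibbs_power6_moment: "(\<integral>\<^sup>+x. ennreal ((1 + norm x) ^ 6) \<partial>gibbs_measure U) < \<infinity>"
proof -
  have "(\<integral>\<^sup>+x. ennreal ((1 + norm x) ^ 6) \<partial>gibbs_measure U)
      = (\<integral>\<^sup>+x. ennreal (1 / partition) * ennreal ((1 + norm x) ^ 6 * exp (- U x)) \<partial>lborel)"
    using partition_pos
    by (subst nn_integral_gibbs) (auto intro!: nn_integral_cong simp: mult_ac simp flip: ennreal_mult)
  also have "\<dots> < \<infinity>"
    using nn_integral_power6_exp_neg_U by (simp add: nn_integral_cmult ennreal_mult_less_top)
  finally show ?thesis .
qed

text \<open>The increment of \<open>U\<close> lies between
  \<open>t * F x - L / 2 * t\<^sup>2\<close> and \<open>t * F x\<close>, by descent and convexity.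
  Multiplication by \<open>F x\<close> preserves or reverses inequalities according to its sign: a
  lower bound on the exponential serves for \<open>F x \<ge> 0\<close>, the quadratic upper bound
  for \<open>F x < 0\<close>. Each case produces one of the two error terms.\<close>

lemma gradU_component_translate:
  fixes i :: 'n and x :: "real ^ 'n"
  assumes "t \<ge> 0"
  defines "F \<equiv> \<lambda>x. gradU x $ i" and "e \<equiv> axis i 1"
  shows "F x * (exp (- U (x - t *\<^sub>R e)) - exp (- U x))
    \<ge> (t * (F x)\<^sup>2 - t\<^sup>2 * ((L * \<bar>F x\<bar> + \<bar>F x\<bar> ^ 3) / 2)) * exp (- U x)"
proof -
  define s where "s = U x - U (x - t *\<^sub>R e)"
  have e: "gradU x \<bullet> e = F x" "norm e = 1"
    by (simp_all add: F_def e_def inner_axis norm_axis_1)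
  have upper: "s \<le> t * F x"
    using convex[of x "x - t *\<^sub>R e"] by (simp add: s_def e)
  have lower: "s \<ge> t * F x - L / 2 * t\<^sup>2"
    using descent[of "x - t *\<^sub>R e" x] by (simp add: s_def e)
  have "F x * (exp s - 1) \<ge> t * (F x)\<^sup>2 - t\<^sup>2 * ((L * \<bar>F x\<bar> + \<bar>F x\<bar> ^ 3) / 2)"
  proof (cases "F x \<ge> 0")
    case True
    have "t * F x - L / 2 * t\<^sup>2 \<le> exp s - 1"
      using lower exp_ge_add_one_self[of s] by linarith
    then have "F x * (t * F x - L / 2 * t\<^sup>2) \<le> F x * (exp s - 1)"
      using True by (rule mult_left_mono)
    moreover have "F x * (t * F x - L / 2 * t\<^sup>2)
        = t * (F x)\<^sup>2 - t\<^sup>2 * ((L * \<bar>F x\<bar> + \<bar>F x\<bar> ^ 3) / 2) + t\<^sup>2 * (\<bar>F x\<bar> ^ 3 / 2)"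
      using True by (simp add: field_simps power2_eq_square)
    moreover have "t\<^sup>2 * (\<bar>F x\<bar> ^ 3 / 2) \<ge> 0" by simp
    ultimately show ?thesis by linarith
  next
    case False
    have "exp s \<le> exp (t * F x)"
      using upper by simp
    also have "\<dots> \<le> 1 + t * F x + (t * F x)\<^sup>2 / 2"
      using False assms(1) by (intro exp_neg_le_quadratic) (simp add: mult_nonneg_nonpos)
    finally have "F x * (t * F x + (t * F x)\<^sup>2 / 2) \<le> F x * (exp s - 1)"
      using False by (intro mult_left_mono_neg) auto
    moreover have "F x * (t * F x + (t * F x)\<^sup>2 / 2)
        = t * (F x)\<^sup>2 - t\<^sup>2 * ((L * \<bar>F x\<bar> + \<bar>F x\<bar> ^ 3) / 2) + t\<^sup>2 * (L * \<bar>F x\<bar> / 2)"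
      using False by (simp add: field_simps power2_eq_square power3_eq_cube)
    moreover have "t\<^sup>2 * (L * \<bar>F x\<bar> / 2) \<ge> 0"
      using L_pos by simp
    ultimately show ?thesis by linarith
  qed
  then have "(t * (F x)\<^sup>2 - t\<^sup>2 * ((L * \<bar>F x\<bar> + \<bar>F x\<bar> ^ 3) / 2)) * exp (- U x)
      \<le> F x * (exp s - 1) * exp (- U x)"
    by (intro mult_right_mono) auto
  also have "\<dots> = F x * (exp (- U (x - t *\<^sub>R e)) - exp (- U x))"
    by (simp add: s_def algebra_simps flip: exp_add)
  finally show ?thesis .
qed

lemma norm_gradU_le_linear: "norm (gradU x) \<le> (norm (gradU 0) + L) * (1 + norm x)"
proof -
  have "(norm (gradU 0) + L) * (1 + norm x) = norm (gradU 0) + L * norm x + (L + norm (gradU 0) * norm x)"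
    by (simp add: algebra_simps)
  moreover have "norm (gradU 0) * norm x \<ge> 0"
    by simp
  ultimately show ?thesis
    using norm_gradU_le[of x] L_pos by linarith
qed

lemma measurable_gradU_component [measurable]: "(\<lambda>x. gradU x $ i) \<in> borel_measurable borel"
  by (rule borel_measurable_continuous_onI) (intro continuous_intros continuous_gradU)

lemma integrable_gradU_power:
  assumes "k \<le> 6"
  shows "integrable lborel (\<lambda>x. \<bar>gradU x $ i\<bar> ^ k * exp (- U x))"
proof (rule integrable_poly_exp_neg_U[where c="(norm (gradU 0) + L) ^ k"])
  fix x
  have "\<bar>gradU x $ i\<bar> ^ k \<le> ((norm (gradU 0) + L) * (1 + norm x)) ^ k"
    using component_le_norm_cart[of "gradU x" i] norm_gradU_le_linear[of x]
    by (intro power_mono) auto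
  also have "\<dots> \<le> (norm (gradU 0) + L) ^ k * (1 + norm x) ^ 6"
    using L_pos assms unfolding power_mult_distrib
    by (intro mult_left_mono power_increasing) auto
  finally show "\<bar>\<bar>gradU x $ i\<bar> ^ k\<bar> \<le> (norm (gradU 0) + L) ^ k * (1 + norm x) ^ 6"
    by simp
qed measurable

text \<open>Integration by parts \<open>E |\<partial>\<^sub>i U|\<^sup>2 = E \<partial>\<^sub>i\<^sub>i U\<close>, with the second derivative replaced by a difference
  quotient because \<open>U\<close> is only \<open>C\<^sup>1\<close>.\<close>
lemma gradU_component_second_moment:
  "(\<integral>x. (gradU x $ i)\<^sup>2 * exp (- U x) \<partial>lborel) \<le> L * partition"
proof -
  define F where "F x = gradU x $ i" for x
  define e where "e = (axis i 1 :: real ^ 'n)"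
  define H where "H x = (L * \<bar>F x\<bar> + \<bar>F x\<bar> ^ 3) / 2" for x
  define C where "C = (\<integral>x. H x * exp (- U x) \<partial>lborel)"
  have [measurable]: "F \<in> borel_measurable borel"
    unfolding F_def by measurable
  have int1: "integrable lborel (\<lambda>x. \<bar>F x\<bar> * exp (- U x))"
    and int2: "integrable lborel (\<lambda>x. (F x)\<^sup>2 * exp (- U x))"
    and int3: "integrable lborel (\<lambda>x. \<bar>F x\<bar> ^ 3 * exp (- U x))"
    using integrable_gradU_power[of 1 i] integrable_gradU_power[of 2 i] integrable_gradU_power[of 3 i]
    by (simp_all add: F_def)
  have intC: "integrable lborel (\<lambda>x. H x * exp (- U x))"
  proof -
    have "integrable lborel (\<lambda>x. L / 2 * (\<bar>F x\<bar> * exp (- U x)) + 1 / 2 * (\<bar>F x\<bar> ^ 3 * exp (- U x)))"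
      by (intro Bochner_Integration.integrable_add integrable_mult_right int1 int3)
    then show ?thesis
      by (simp add: H_def field_simps)
  qed
  have intF: "integrable lborel (\<lambda>x. F x * exp (- U x))"
    by (rule Bochner_Integration.integrable_bound[OF int1]) (auto simp: abs_mult)
  have bound: "(\<integral>x. (F x)\<^sup>2 * exp (- U x) \<partial>lborel) \<le> L * partition + t * C" if t: "t > 0" for t
  proof -
    have F_lip: "\<bar>F (y + t *\<^sub>R e) - F y\<bar> \<le> L * t" for y
    proof -
      have "\<bar>F (y + t *\<^sub>R e) - F y\<bar> \<le> norm (gradU (y + t *\<^sub>R e) - gradU y)"
        using component_le_norm_cart[of "gradU (y + t *\<^sub>R e) - gradU y" i] by (simp add: F_def)
      also have "\<dots> \<le> L * t"
        using lipschitz[of "y + t *\<^sub>R e" y] t by (simp add: e_def norm_axis_1)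
      finally show ?thesis .
    qed
    have intdiff: "integrable lborel (\<lambda>y. (F (y + t *\<^sub>R e) - F y) * exp (- U y))"
    proof (rule Bochner_Integration.integrable_bound)
      show "integrable lborel (\<lambda>y. L * t * exp (- U y))"
        by (intro integrable_mult_right integrable_exp_neg_U)
      show "AE y in lborel. norm ((F (y + t *\<^sub>R e) - F y) * exp (- U y)) \<le> norm (L * t * exp (- U y))"
        using F_lip L_pos t by (auto simp: abs_mult intro!: mult_right_mono)
    qed measurable
    have intshift: "integrable lborel (\<lambda>y. F (y + t *\<^sub>R e) * exp (- U y))"
      using Bochner_Integration.integrable_add[OF intdiff intF] by (simp add: algebra_simps)
    let ?h = "\<lambda>x. F x * exp (- U (x - t *\<^sub>R e))"
    \<comment> \<open>Translation invariance moves the shift from the weight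
      \<open>exp (- U x)\<close> to \<open>F\<close>; this is the discrete integration by
      parts.\<close>
    have shift: "distr lborel borel ((+) (t *\<^sub>R e)) = lborel"
      by (rule lborel_distr_plus)
    have inth: "integrable lborel ?h"
      using intshift by (subst shift[symmetric]) (simp add: integrable_distr_eq add.commute)
    have h: "(\<integral>x. ?h x \<partial>lborel) = (\<integral>y. F (y + t *\<^sub>R e) * exp (- U y) \<partial>lborel)"
      by (subst shift[symmetric]) (simp add: integral_distr add.commute)
    have "t * (\<integral>x. (F x)\<^sup>2 * exp (- U x) \<partial>lborel) - t\<^sup>2 * C
       = (\<integral>x. (t * (F x)\<^sup>2 - t\<^sup>2 * H x) * exp (- U x) \<partial>lborel)"
      unfolding C_def left_diff_distrib mult.assoc
      using int2 intC by (simp add: mult.assoc)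
    also have "\<dots> \<le> (\<integral>x. F x * (exp (- U (x - t *\<^sub>R e)) - exp (- U x)) \<partial>lborel)"
    proof (rule integral_mono)
      show "integrable lborel (\<lambda>x. (t * (F x)\<^sup>2 - t\<^sup>2 * H x) * exp (- U x))"
        using int2 intC unfolding left_diff_distrib mult.assoc by (simp add: mult.assoc)
      show "integrable lborel (\<lambda>x. F x * (exp (- U (x - t *\<^sub>R e)) - exp (- U x)))"
        using inth intF unfolding right_diff_distrib by (rule Bochner_Integration.integrable_diff)
      show "(t * (F x)\<^sup>2 - t\<^sup>2 * H x) * exp (- U x)
          \<le> F x * (exp (- U (x - t *\<^sub>R e)) - exp (- U x))" for x
        using gradU_component_translate[of t x i] t by (simp add: F_def e_def H_def)
    qed
    also have "\<dots> = (\<integral>y. (F (y + t *\<^sub>R e) - F y) * exp (- U y) \<partial>lborel)"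
      using inth intF intshift by (simp add: right_diff_distrib left_diff_distrib h)
    also have "\<dots> \<le> (\<integral>y. L * t * exp (- U y) \<partial>lborel)"
    proof (rule integral_mono[OF intdiff])
      show "(F (y + t *\<^sub>R e) - F y) * exp (- U y) \<le> L * t * exp (- U y)" for y
        using F_lip[of y] by (intro mult_right_mono) auto
    qed (intro integrable_mult_right integrable_exp_neg_U)
    also have "\<dots> = L * t * partition"
      by (simp add: partition_def)
    finally have "t * (\<integral>x. (F x)\<^sup>2 * exp (- U x) \<partial>lborel) \<le> t * (L * partition + t * C)"
      by (simp add: algebra_simps power2_eq_square)
    then show ?thesis
      using t by simp
  qed
  have "((\<lambda>t. L * partition + t * C) \<longlongrightarrow> L * partition + 0 * C) (at_right 0)"
    by (intro tendsto_intros)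
  moreover have "\<forall>\<^sub>F t in at_right 0. (\<integral>x. (F x)\<^sup>2 * exp (- U x) \<partial>lborel) \<le> L * partition + t * C"
    using bound by (auto simp: eventually_at_filter)
  ultimately have "(\<integral>x. (F x)\<^sup>2 * exp (- U x) \<partial>lborel) \<le> L * partition + 0 * C"
    by (rule tendsto_lowerbound) simp
  then show ?thesis
    by (simp add: F_def)
qed

lemma gradU_second_moment:
  "(\<integral>\<^sup>+x. ennreal ((norm (gradU x))\<^sup>2) \<partial>gibbs_measure U) \<le> ennreal (L * CARD('n))"
proof -
  have int: "integrable lborel (\<lambda>x. (gradU x $ i)\<^sup>2 * exp (- U x))" for i
    using integrable_gradU_power[of 2 i] by simp
  have eq: "exp (- U x) / partition * (norm (gradU x))\<^sup>2
      = (\<Sum>i\<in>UNIV. (gradU x $ i)\<^sup>2 * exp (- U x)) / partition" for x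
    by (simp add: norm_vec_def L2_set_def sum_nonneg sum_distrib_right sum_distrib_left
        sum_divide_distrib mult.commute)
  have "(\<integral>\<^sup>+x. ennreal ((norm (gradU x))\<^sup>2) \<partial>gibbs_measure U)
      = (\<integral>\<^sup>+x. ennreal ((\<Sum>i\<in>UNIV. (gradU x $ i)\<^sup>2 * exp (- U x)) / partition) \<partial>lborel)"
  proof (subst nn_integral_gibbs)
    have "ennreal (exp (- U x) / partition) * ennreal ((norm (gradU x))\<^sup>2)
        = ennreal ((\<Sum>i\<in>UNIV. (gradU x $ i)\<^sup>2 * exp (- U x)) / partition)" for x
      unfolding eq[symmetric] using partition_pos by (intro ennreal_mult[symmetric]) auto
    then show "(\<integral>\<^sup>+x. ennreal (exp (- U x) / partition) * ennreal ((norm (gradU x))\<^sup>2) \<partial>lborel)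
        = (\<integral>\<^sup>+x. ennreal ((\<Sum>i\<in>UNIV. (gradU x $ i)\<^sup>2 * exp (- U x)) / partition) \<partial>lborel)"
      by simp
  qed measurable
  also have "\<dots> = ennreal (\<integral>x. (\<Sum>i\<in>UNIV. (gradU x $ i)\<^sup>2 * exp (- U x)) / partition \<partial>lborel)"
    using int partition_pos by (intro nn_integral_eq_integral) (auto intro!: sum_nonneg divide_nonneg_pos)
  also have "(\<integral>x. (\<Sum>i\<in>UNIV. (gradU x $ i)\<^sup>2 * exp (- U x)) / partition \<partial>lborel)
      = (\<Sum>i\<in>UNIV. (\<integral>x. (gradU x $ i)\<^sup>2 * exp (- U x) \<partial>lborel)) / partition"
    using int by simp
  also have "\<dots> \<le> (\<Sum>i\<in>(UNIV::'n set). L * partition) / partition"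
    using partition_pos by (intro divide_right_mono sum_mono gradU_component_second_moment) auto
  also have "\<dots> = L * CARD('n)"
    using partition_pos by simp
  finally show ?thesis
    by (simp add: ennreal_leI)
qed

end

subsection \<open>The Metropolis-adjusted Langevin kernel\<close>

text \<open>The law of a sum of \<open>k\<close> independent standard Gaussians. The empty sum is
  separate because a normal density with standard deviation 0 is 0 by division by zero, so
  \<open>isotropic_gaussian 0 0\<close> is the null measure and not a point mass.\<close>

definition noise_law :: "nat \<Rightarrow> (real ^ 'n) measure" where
  "noise_law k = (if k = 0 then return borel 0 else isotropic_gaussian 0 (real k))"

lemma sets_noise_law [simp, measurable_cong]: "sets (noise_law k) = sets borel"
  by (simp add: noise_law_def)

lemma space_noise_law [simp]: "space (noise_law k) = UNIV"
  by (simp add: noise_law_def)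

lemma noise_law_Suc:
  fixes \<phi> :: "real ^ 'n \<Rightarrow> ennreal"
  assumes [measurable]: "\<phi> \<in> borel_measurable borel"
  shows "(\<integral>\<^sup>+s. \<integral>\<^sup>+z. \<phi> (s + z) \<partial>isotropic_gaussian 0 1 \<partial>noise_law k) = (\<integral>\<^sup>+s. \<phi> s \<partial>noise_law (Suc k))"
proof (cases "k = 0")
  case True
  interpret prob_space "isotropic_gaussian 0 1 :: (real ^ 'n) measure"
    by (rule prob_space_isotropic_gaussian) simp
  show ?thesis
    using True by (simp add: noise_law_def nn_integral_return)
next
  case False
  then show ?thesis
    using nn_integral_isotropic_gaussian_add[of "real k" 1 \<phi>] by (simp add: noise_law_def add.commute)
qed

lemma noise_law_second_moment:
  "(\<integral>\<^sup>+s. ennreal ((norm s)\<^sup>2) \<partial>(noise_law k :: (real ^ 'n) measure)) = ennreal (real k * CARD('n))"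
  by (cases "k = 0") (simp_all add: noise_law_def nn_integral_return isotropic_gaussian_second_moment)

abbreviation uniform_01 :: "real measure" where
  "uniform_01 \<equiv> uniform_measure lborel {0..1}"

lemma prob_space_uniform_01: "prob_space uniform_01"
  by (rule prob_space_uniform_measure) auto

lemma nn_integral_uniform_01_if:
  assumes "0 \<le> p" "p \<le> 1"
  shows "(\<integral>\<^sup>+u. (if u \<le> p then a else b) \<partial>uniform_01) = ennreal p * a + ennreal (1 - p) * b"
proof -
  have "(\<integral>\<^sup>+u. (if u \<le> p then a else b) \<partial>uniform_01)
      = (\<integral>\<^sup>+u. a * indicator {0..p} u + b * indicator {p<..1} u \<partial>lborel)"
    using assms
    by (subst nn_integral_uniform_measure)
       (auto intro!: nn_integral_cong simp: divide_ennreal_def split: split_indicator)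
  also have "\<dots> = ennreal p * a + ennreal (1 - p) * b"
    using assms by (simp add: nn_integral_add nn_integral_cmult mult.commute)
  finally show ?thesis .
qed

text \<open>The uniform variable decides acceptance, so a Metropolis step is a deterministic
  function of state and noise. The Gaussian component stays accessible and can be shared with the
  Euler step.\<close>

definition mala_noise :: "((real ^ 'n) \<times> real) measure" where
  "mala_noise = isotropic_gaussian 0 1 \<Otimes>\<^sub>M uniform_01"

lemma sets_mala_noise [simp, measurable_cong]: "sets mala_noise = sets (borel \<Otimes>\<^sub>M borel)"
  unfolding mala_noise_def by (intro sets_pair_measure_cong) auto

lemma prob_space_mala_noise: "prob_space (mala_noise :: ((real ^ 'n) \<times> real) measure)"
proof -
  interpret G: prob_space "isotropic_gaussian 0 1 :: (real ^ 'n) measure"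
    by (rule prob_space_isotropic_gaussian) simp
  interpret V: prob_space uniform_01
    by (rule prob_space_uniform_01)
  interpret pair_prob_space "isotropic_gaussian 0 1 :: (real ^ 'n) measure" uniform_01 ..
  show ?thesis
    unfolding mala_noise_def by (rule P.prob_space_axioms)
qed

lemma nn_integral_mala_noise:
  assumes [measurable]: "\<phi> \<in> borel_measurable (borel \<Otimes>\<^sub>M borel)"
  shows "(\<integral>\<^sup>+\<omega>. \<phi> \<omega> \<partial>mala_noise) = (\<integral>\<^sup>+z. \<integral>\<^sup>+u. \<phi> (z, u) \<partial>uniform_01 \<partial>isotropic_gaussian 0 1)"
proof -
  interpret V: prob_space uniform_01
    by (rule prob_space_uniform_01)
  show ?thesis
    unfolding mala_noise_def by (rule V.nn_integral_fst[symmetric]) measurable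
qed

lemma nn_integral_mala_noise_fst:
  fixes \<phi> :: "real ^ 'n \<Rightarrow> ennreal"
  assumes [measurable]: "\<phi> \<in> borel_measurable borel"
  shows "(\<integral>\<^sup>+\<omega>. \<phi> (fst \<omega>) \<partial>mala_noise) = (\<integral>\<^sup>+z. \<phi> z \<partial>isotropic_gaussian 0 1)"
proof -
  interpret V: prob_space uniform_01
    by (rule prob_space_uniform_01)
  show ?thesis
    using V.emeasure_space_1 by (subst nn_integral_mala_noise) simp_all
qed

lemma isotropic_gaussian_density_eq:
  fixes a :: "real ^ 'n"
  assumes "v > 0"
  shows "(\<Prod>i\<in>UNIV. normal_density (a $ i) (sqrt v) (y $ i))
     = (1 / sqrt (2 * pi * v)) ^ CARD('n) * exp (- (norm (y - a))\<^sup>2 / (2 * v))"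
  using assms
  by (simp add: normal_density_def prod.distrib norm_vec_def L2_set_def sum_nonneg exp_sum
      sum_divide_distrib power_divide prod_dividef flip: sum_negf)

context strongly_convex_potential
begin

definition proposal :: "real \<Rightarrow> real ^ 'n \<Rightarrow> real ^ 'n \<Rightarrow> real ^ 'n" where
  "proposal h x z = x - h *\<^sub>R gradU x + sqrt (2 * h) *\<^sub>R z"

definition mala_step :: "real \<Rightarrow> real ^ 'n \<Rightarrow> (real ^ 'n) \<times> real \<Rightarrow> real ^ 'n" where
  "mala_step h x \<omega> =
     (if snd \<omega> \<le> accept h x (proposal h x (fst \<omega>)) then proposal h x (fst \<omega>) else x)"

lemma measurable_proposal [measurable (raw)]:
  assumes [measurable]: "f \<in> borel_measurable M" "g \<in> borel_measurable M"
  shows "(\<lambda>\<omega>. proposal h (f \<omega>) (g \<omega>)) \<in> borel_measurable M"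
  unfolding proposal_def by measurable

lemma measurable_mala_step [measurable (raw)]:
  assumes [measurable]: "f \<in> borel_measurable M" "g \<in> measurable M (borel \<Otimes>\<^sub>M borel)"
  shows "(\<lambda>\<omega>. mala_step h (f \<omega>) (g \<omega>)) \<in> borel_measurable M"
  unfolding mala_step_def by measurable

text \<open>The test function sees the Gaussian increment as well as the new point, because the
  coupling error compares the two.\<close>

lemma nn_integral_mala_noise_step:
  fixes \<phi> :: "real ^ 'n \<Rightarrow> real ^ 'n \<Rightarrow> ennreal"
  assumes [measurable]: "case_prod \<phi> \<in> borel_measurable (borel \<Otimes>\<^sub>M borel)"
  shows "(\<integral>\<^sup>+\<omega>. \<phi> (fst \<omega>) (mala_step h x \<omega>) \<partial>mala_noise)
    = (\<integral>\<^sup>+z. ennreal (accept h x (proposal h x z)) * \<phi> z (proposal h x z)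
          + ennreal (1 - accept h x (proposal h x z)) * \<phi> z x \<partial>isotropic_gaussian 0 1)"
proof -
  have "(\<lambda>\<omega>. \<phi> (fst \<omega>) (mala_step h x \<omega>)) \<in> borel_measurable (borel \<Otimes>\<^sub>M borel)"
    by measurable
  from nn_integral_mala_noise[OF this] show ?thesis
    by (simp add: mala_step_def if_distrib[of "\<phi> _"] nn_integral_uniform_01_if accept_bounds cong: if_cong)
qed

lemma log_ratio_balance:
  assumes "h > 0"
  shows "exp (- U x) * exp (- (norm (y - (x - h *\<^sub>R gradU x)))\<^sup>2 / (4 * h)) * exp (log_ratio h x y)
     = exp (- U y) * exp (- (norm (x - (y - h *\<^sub>R gradU y)))\<^sup>2 / (4 * h))"
  by (simp add: log_ratio_def flip: exp_add)

text \<open>Detailed balance. The accepted flow \<open>s x y\<close> is the minimum of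
  \<open>p x * q x y\<close> and \<open>p y * q y x\<close>, hence symmetric, and Tonelli lets its
  variables be exchanged. Together with the rejected flow \<open>r x y\<close>, which stays at
  \<open>x\<close>, it gives \<open>p x * q x y\<close>, whose integral over \<open>y\<close> is
  \<open>p x\<close>.\<close>

theorem mala_step_invariant:
  fixes \<phi> :: "real ^ 'n \<Rightarrow> ennreal"
  assumes "h > 0" and [measurable]: "\<phi> \<in> borel_measurable borel"
  shows "(\<integral>\<^sup>+x. \<integral>\<^sup>+\<omega>. \<phi> (mala_step h x \<omega>) \<partial>mala_noise \<partial>gibbs_measure U) = (\<integral>\<^sup>+x. \<phi> x \<partial>gibbs_measure U)"
proof -
  define p where "p x = exp (- U x) / partition" for x
  define q where "q x y = (\<Prod>i\<in>UNIV. normal_density ((x - h *\<^sub>R gradU x) $ i) (sqrt (2 * h)) (y $ i))" for x y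
  define s where "s x y = p x * q x y * accept h x y" for x y
  define r where "r x y = p x * q x y * (1 - accept h x y)" for x y
  have p_nonneg: "p x \<ge> 0" for x
    using partition_pos by (simp add: p_def)
  have q_eq: "q x y = (1 / sqrt (2 * pi * (2 * h))) ^ CARD('n) * exp (- (norm (y - (x - h *\<^sub>R gradU x)))\<^sup>2 / (4 * h))" for x y
    using assms(1) unfolding q_def by (subst isotropic_gaussian_density_eq) auto
  have q_nonneg: "q x y \<ge> 0" for x y
    unfolding q_def by (intro prod_nonneg) simp
  have [measurable]: "p \<in> borel_measurable borel"
    unfolding p_def by measurable
  have [measurable]: "case_prod q \<in> borel_measurable (borel \<Otimes>\<^sub>M borel)"
    unfolding q_eq by measurable
  have [measurable]: "case_prod s \<in> borel_measurable (borel \<Otimes>\<^sub>M borel)"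
    "case_prod r \<in> borel_measurable (borel \<Otimes>\<^sub>M borel)"
    unfolding s_def r_def by measurable
  have balance: "p x * q x y * exp (log_ratio h x y) = p y * q y x" for x y
    using log_ratio_balance[OF assms(1), of x y] by (simp add: p_def q_eq mult_ac)
  have s_min: "s x y = min (p x * q x y) (p y * q y x)" for x y
    using p_nonneg[of x] q_nonneg[of x y] unfolding s_def accept_def balance[of x y, symmetric]
    by (simp add: min_mult_distrib_left mult_ac)
  have s_sym: "s x y = s y x" for x y
    by (simp add: s_min min.commute)
  have nonneg: "s x y \<ge> 0" "r x y \<ge> 0" for x y
    using p_nonneg q_nonneg accept_bounds by (auto simp: s_def r_def)
  have sr: "s x y + r x y = p x * q x y" for x y
    by (simp add: s_def r_def algebra_simps)
  have q_total: "(\<integral>\<^sup>+y. ennreal (q x y) \<partial>lborel) = 1" for x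
  proof -
    interpret prob_space "isotropic_gaussian (x - h *\<^sub>R gradU x) (2 * h)"
      using assms(1) by (intro prob_space_isotropic_gaussian) simp
    show ?thesis
      using nn_integral_isotropic_gaussian[of "\<lambda>_. 1" "x - h *\<^sub>R gradU x" "2 * h"] emeasure_space_1
      by (simp add: q_def)
  qed
  have step: "(\<integral>\<^sup>+\<omega>. \<phi> (mala_step h x \<omega>) \<partial>mala_noise)
     = (\<integral>\<^sup>+y. ennreal (q x y) * (ennreal (accept h x y) * \<phi> y + ennreal (1 - accept h x y) * \<phi> x) \<partial>lborel)" for x
  proof -
    have "(\<integral>\<^sup>+\<omega>. \<phi> (mala_step h x \<omega>) \<partial>mala_noise)
      = (\<integral>\<^sup>+z. ennreal (accept h x (proposal h x z)) * \<phi> (proposal h x z)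
          + ennreal (1 - accept h x (proposal h x z)) * \<phi> x \<partial>isotropic_gaussian 0 1)"
      by (rule nn_integral_mala_noise_step) measurable
    also have "\<dots> = (\<integral>\<^sup>+y. ennreal (accept h x y) * \<phi> y + ennreal (1 - accept h x y) * \<phi> x
        \<partial>distr (isotropic_gaussian 0 1) borel (\<lambda>z. (x - h *\<^sub>R gradU x) + sqrt (2 * h) *\<^sub>R z))"
      by (subst nn_integral_distr) (auto simp: proposal_def)
    also have "\<dots> = (\<integral>\<^sup>+y. ennreal (accept h x y) * \<phi> y + ennreal (1 - accept h x y) * \<phi> x
        \<partial>isotropic_gaussian (x - h *\<^sub>R gradU x) (2 * h))"
      using assms(1) by (subst isotropic_gaussian_affine) auto
    also have "\<dots> = (\<integral>\<^sup>+y. ennreal (q x y) * (ennreal (accept h x y) * \<phi> y + ennreal (1 - accept h x y) * \<phi> x) \<partial>lborel)"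
      unfolding q_def by (rule nn_integral_isotropic_gaussian) measurable
    finally show ?thesis .
  qed
  have "(\<integral>\<^sup>+x. \<integral>\<^sup>+\<omega>. \<phi> (mala_step h x \<omega>) \<partial>mala_noise \<partial>gibbs_measure U)
     = (\<integral>\<^sup>+x. ennreal (p x) * (\<integral>\<^sup>+y. ennreal (q x y) * (ennreal (accept h x y) * \<phi> y + ennreal (1 - accept h x y) * \<phi> x) \<partial>lborel) \<partial>lborel)"
    unfolding step p_def by (rule nn_integral_gibbs) measurable
  also have "\<dots> = (\<integral>\<^sup>+x. \<integral>\<^sup>+y. ennreal (s x y) * \<phi> y + ennreal (r x y) * \<phi> x \<partial>lborel \<partial>lborel)"
  proof -
    have "ennreal (p x) * (\<integral>\<^sup>+y. ennreal (q x y) * (ennreal (accept h x y) * \<phi> y + ennreal (1 - accept h x y) * \<phi> x) \<partial>lborel)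
        = (\<integral>\<^sup>+y. ennreal (s x y) * \<phi> y + ennreal (r x y) * \<phi> x \<partial>lborel)" for x
      using p_nonneg q_nonneg accept_bounds
      by (subst nn_integral_cmult[symmetric])
         (auto intro!: nn_integral_cong simp: s_def r_def ennreal_mult distrib_left mult_ac)
    then show ?thesis by simp
  qed
  also have "\<dots> = (\<integral>\<^sup>+x. \<integral>\<^sup>+y. ennreal (s x y) * \<phi> y \<partial>lborel \<partial>lborel) + (\<integral>\<^sup>+x. \<integral>\<^sup>+y. ennreal (r x y) * \<phi> x \<partial>lborel \<partial>lborel)"
    by (simp add: nn_integral_add)
  also have "(\<integral>\<^sup>+x. \<integral>\<^sup>+y. ennreal (s x y) * \<phi> y \<partial>lborel \<partial>lborel) = (\<integral>\<^sup>+y. \<integral>\<^sup>+x. ennreal (s x y) * \<phi> y \<partial>lborel \<partial>lborel)"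
    by (rule lborel_pair.Fubini') measurable
  also have "\<dots> = (\<integral>\<^sup>+x. \<integral>\<^sup>+y. ennreal (s x y) * \<phi> x \<partial>lborel \<partial>lborel)"
    by (intro nn_integral_cong) (metis s_sym)
  also have "\<dots> + (\<integral>\<^sup>+x. \<integral>\<^sup>+y. ennreal (r x y) * \<phi> x \<partial>lborel \<partial>lborel)
     = (\<integral>\<^sup>+x. \<integral>\<^sup>+y. ennreal (p x) * \<phi> x * ennreal (q x y) \<partial>lborel \<partial>lborel)"
  proof -
    have "ennreal (p x) * \<phi> x * ennreal (q x y) = ennreal (s x y) * \<phi> x + ennreal (r x y) * \<phi> x" for x y
      using p_nonneg q_nonneg nonneg sr[of x y, symmetric]
      by (simp add: mult_ac flip: distrib_right ennreal_plus ennreal_mult)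
         (simp add: ennreal_mult distrib_left mult_ac)
    then show ?thesis
      by (simp add: nn_integral_add)
  qed
  also have "\<dots> = (\<integral>\<^sup>+x. ennreal (p x) * \<phi> x \<partial>lborel)"
    by (simp add: nn_integral_cmult q_total)
  also have "\<dots> = (\<integral>\<^sup>+x. \<phi> x \<partial>gibbs_measure U)"
    unfolding p_def by (rule nn_integral_gibbs[symmetric]) measurable
  finally show ?thesis .
qed

end

subsection \<open>The synchronous coupling\<close>

type_synonym 'v chain_state = "('v \<times> 'v) \<times> 'v \<times> 'v \<times> 'v"

text \<open>Cauchy-Schwarz against the constant 1. The resulting factor \<open>sqrt (1 / 2)\<close>
  later cancels the \<open>sqrt 2\<close> in the noise scale \<open>sqrt (2 * h)\<close>.\<close>

lemma sum_sqrt_le: "(\<Sum>j<N. sqrt (real j)) \<le> real N * sqrt (real N / 2)"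
proof (rule power2_le_imp_le)
  have "(\<Sum>j<N. sqrt (real j) * 1)\<^sup>2 \<le> (\<Sum>j<N. (sqrt (real j))\<^sup>2) * (\<Sum>j<N. 1\<^sup>2)"
    by (rule Cauchy_Schwarz_ineq_sum)
  also have "\<dots> \<le> (real N)\<^sup>2 / 2 * real N"
  proof -
    have "(\<Sum>j<N. real j) \<le> (real N)\<^sup>2 / 2"
      by (induction N) (auto simp: power2_eq_square field_simps)
    from mult_right_mono[OF this, of "real N"] show ?thesis
      by simp
  qed
  also have "\<dots> = (real N * sqrt (real N / 2))\<^sup>2"
    by (simp add: power_mult_distrib)
  finally show "(\<Sum>j<N. sqrt (real j))\<^sup>2 \<le> (real N * sqrt (real N / 2))\<^sup>2"
    by simp
qed simp

context strongly_convex_potential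
begin

abbreviation state_space :: "(real ^ 'n) chain_state measure" where
  "state_space \<equiv> (borel \<Otimes>\<^sub>M borel) \<Otimes>\<^sub>M borel \<Otimes>\<^sub>M borel \<Otimes>\<^sub>M borel"

text \<open>A state \<open>((x\<^sub>0, y\<^sub>0), x, s, g)\<close> consists of the initial pair, the current point of the Metropolis
  chain, the sum of the Gaussian increments, and the accumulated drift.\<close>
definition update :: "real \<Rightarrow> (real ^ 'n) chain_state \<Rightarrow> (real ^ 'n) \<times> real \<Rightarrow> (real ^ 'n) chain_state" where
  "update h \<sigma> \<omega> = (case \<sigma> of (p, x, s, g) \<Rightarrow>
     (p, mala_step h x \<omega>, s + fst \<omega>, g + h *\<^sub>R gradU x))"

lemma update_simps [simp]:
  "fst (update h \<sigma> \<omega>) = fst \<sigma>"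
  "fst (snd (update h \<sigma> \<omega>)) = mala_step h (fst (snd \<sigma>)) \<omega>"
  "fst (snd (snd (update h \<sigma> \<omega>))) = fst (snd (snd \<sigma>)) + fst \<omega>"
  "snd (snd (snd (update h \<sigma> \<omega>))) = snd (snd (snd \<sigma>)) + h *\<^sub>R gradU (fst (snd \<sigma>))"
  by (simp_all add: update_def split: prod.split)

lemma measurable_update [measurable]:
  "(\<lambda>z. update h (fst z) (snd z)) \<in> measurable (state_space \<Otimes>\<^sub>M (borel \<Otimes>\<^sub>M borel)) state_space"
  unfolding update_def case_prod_beta by measurable

text \<open>Every step adjoins a fresh copy of the noise, so claims about the chain reduce to
  integrals over one noise variable. The initial pair stays in the state because the Euler step
  starts from its second component.\<close>

primrec chain :: "real \<Rightarrow> ((real ^ 'n) \<times> (real ^ 'n)) measure \<Rightarrow> nat \<Rightarrow> (real ^ 'n) chain_state measure" where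
  "chain h \<zeta> 0 = distr \<zeta> state_space (\<lambda>p. (p, fst p, 0, 0))"
| "chain h \<zeta> (Suc k) = distr (chain h \<zeta> k \<Otimes>\<^sub>M mala_noise) state_space (\<lambda>z. update h (fst z) (snd z))"

lemma sets_chain [simp, measurable_cong]: "sets (chain h \<zeta> k) = sets state_space"
  by (cases k) auto

lemma measurable_update_chain [measurable]:
  "(\<lambda>z. update h (fst z) (snd z)) \<in> measurable (chain h \<zeta> k \<Otimes>\<^sub>M mala_noise) state_space"
  by measurable

lemma nn_integral_chain_Suc:
  assumes [measurable]: "\<phi> \<in> borel_measurable state_space"
  shows "(\<integral>\<^sup>+\<sigma>. \<phi> \<sigma> \<partial>chain h \<zeta> (Suc k)) = (\<integral>\<^sup>+\<sigma>. \<integral>\<^sup>+\<omega>. \<phi> (update h \<sigma> \<omega>) \<partial>mala_noise \<partial>chain h \<zeta> k)"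
proof -
  interpret V: prob_space mala_noise
    by (rule prob_space_mala_noise)
  have "sigma_finite_measure (mala_noise :: ((real ^ 'n) \<times> real) measure)"
    by unfold_locales
  from nn_integral_distr_pair[OF this measurable_update_chain assms] show ?thesis
    by simp
qed

lemma nn_integral_chain_Suc_const:
  assumes "\<phi> \<in> borel_measurable state_space" and "\<And>\<sigma> \<omega>. \<phi> (update h \<sigma> \<omega>) = \<psi> \<sigma>"
  shows "(\<integral>\<^sup>+\<sigma>. \<phi> \<sigma> \<partial>chain h \<zeta> (Suc k)) = (\<integral>\<^sup>+\<sigma>. \<psi> \<sigma> \<partial>chain h \<zeta> k)"
proof -
  interpret V: prob_space mala_noise
    by (rule prob_space_mala_noise)
  show ?thesis
    unfolding nn_integral_chain_Suc[OF assms(1)] assms(2) by (simp add: V.emeasure_space_1)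
qed

lemma l2_bounded_chain_Suc:
  assumes "l2_bounded (chain h \<zeta> k) \<psi> c" and [measurable]: "\<phi> \<in> borel_measurable state_space"
    and "\<And>\<sigma> \<omega>. \<phi> (update h \<sigma> \<omega>) = \<psi> \<sigma>"
  shows "l2_bounded (chain h \<zeta> (Suc k)) \<phi> c"
  using assms(1) unfolding l2_bounded_def
  by (subst nn_integral_chain_Suc_const[where \<psi>="\<lambda>\<sigma>. ennreal ((norm (\<psi> \<sigma>))\<^sup>2)"]) (simp_all add: assms(3))

text \<open>Up to the factor \<open>h\<^sup>2\<close>, the sixth power bounds the squared
  conditional mean of the rejection displacement divided by \<open>h\<close>, and the fourth power
  bounds its second moment.\<close>

definition rejection_integrand :: "real ^ 'n \<Rightarrow> real ^ 'n \<Rightarrow> real" where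
  "rejection_integrand x z =
     reject_const\<^sup>2 * (norm (gradU x) + 2 * norm z) ^ 6 + reject_const * (norm (gradU x) + 2 * norm z) ^ 4"

definition rejection_total :: ennreal where
  "rejection_total = (\<integral>\<^sup>+x. \<integral>\<^sup>+z. ennreal (rejection_integrand x z) \<partial>isotropic_gaussian 0 1 \<partial>gibbs_measure U)"

lemma reject_const_nonneg: "reject_const \<ge> 0"
  using L_pos by (simp add: reject_const_def)

lemma measurable_rejection_integrand [measurable]:
  "case_prod rejection_integrand \<in> borel_measurable (borel \<Otimes>\<^sub>M borel)"
  unfolding rejection_integrand_def by measurable

text \<open>The base of the powers is at most a constant times
  \<open>(1 + norm x) * (1 + norm z)\<close>. The integrand is therefore dominated by a product of
  sixth powers, which splits into one moment of each measure.\<close>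

lemma rejection_total_finite: "rejection_total < \<infinity>"
proof -
  define B where "B = norm (gradU 0) + L + 2"
  define c where "c = reject_const\<^sup>2 * B ^ 6 + reject_const * B ^ 4"
  have B: "B \<ge> 1"
    using L_pos by (simp add: B_def)
  have c: "c \<ge> 0"
    using B reject_const_nonneg by (simp add: c_def)
  have bound: "rejection_integrand x z \<le> c * ((1 + norm x) ^ 6 * (1 + norm z) ^ 6)" for x z
  proof -
    let ?w = "norm (gradU x) + 2 * norm z" and ?t = "(1 + norm x) * (1 + norm z)"
    have t: "?t \<ge> 1"
      using mult_mono[of 1 "1 + norm x" 1 "1 + norm z"] by simp
    have "norm (gradU x) \<le> (norm (gradU 0) + L) * ?t"
    proof -
      have "norm (gradU x) \<le> (norm (gradU 0) + L) * ((1 + norm x) * 1)"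
        using norm_gradU_le_linear[of x] by simp
      also have "\<dots> \<le> (norm (gradU 0) + L) * ?t"
        using L_pos by (intro mult_left_mono) auto
      finally show ?thesis .
    qed
    moreover have "norm z \<le> ?t"
      using mult_mono[of 1 "1 + norm x" "norm z" "1 + norm z"] by simp
    moreover have "B * ?t = (norm (gradU 0) + L) * ?t + 2 * ?t"
      unfolding B_def by (rule distrib_right)
    ultimately have w: "?w \<le> B * ?t"
      by linarith
    have w6: "?w ^ 6 \<le> B ^ 6 * ?t ^ 6"
      using power_mono[OF w, of 6] by (simp add: power_mult_distrib)
    have "?w ^ 4 \<le> B ^ 4 * ?t ^ 4"
      using power_mono[OF w, of 4] by (simp add: power_mult_distrib)
    also have "\<dots> \<le> B ^ 4 * ?t ^ 6"
      using B t by (intro mult_left_mono power_increasing) auto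
    finally have w4: "?w ^ 4 \<le> B ^ 4 * ?t ^ 6" .
    have "rejection_integrand x z \<le> reject_const\<^sup>2 * (B ^ 6 * ?t ^ 6) + reject_const * (B ^ 4 * ?t ^ 6)"
      unfolding rejection_integrand_def using reject_const_nonneg
      by (intro add_mono mult_left_mono w6 w4) auto
    then show ?thesis
      by (simp only: c_def power_mult_distrib) (simp only: distrib_right mult.assoc)
  qed
  have "rejection_total \<le> (\<integral>\<^sup>+x. \<integral>\<^sup>+z. ennreal (c * ((1 + norm x) ^ 6 * (1 + norm z) ^ 6))
      \<partial>(isotropic_gaussian 0 1 :: (real ^ 'n) measure) \<partial>gibbs_measure U)"
    unfolding rejection_total_def by (intro nn_integral_mono ennreal_leI bound)
  also have "\<dots> = (\<integral>\<^sup>+x. \<integral>\<^sup>+z. ennreal c * ennreal ((1 + norm x) ^ 6) * ennreal ((1 + norm z) ^ 6)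
      \<partial>(isotropic_gaussian 0 1 :: (real ^ 'n) measure) \<partial>gibbs_measure U)"
    using c by (simp add: ennreal_mult mult.assoc)
  also have "\<dots> = ennreal c * (\<integral>\<^sup>+x. ennreal ((1 + norm x) ^ 6) \<partial>gibbs_measure U)
      * (\<integral>\<^sup>+z. ennreal ((1 + norm z) ^ 6) \<partial>(isotropic_gaussian 0 1 :: (real ^ 'n) measure))"
    by (simp add: nn_integral_cmult nn_integral_multc)
  also have "\<dots> < \<infinity>"
    using gibbs_power6_moment gaussian_power6_moment[where 'n='n] by (simp add: ennreal_mult_less_top)
  finally show ?thesis .
qed

text \<open>It vanishes as long as all proposals are accepted, for then the current point is the
  initial one minus the drift plus the scaled noise. In general it is the total displacement caused
  by rejections.\<close>

definition coupling_error :: "real \<Rightarrow> (real ^ 'n) chain_state \<Rightarrow> real ^ 'n" where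
  "coupling_error h \<sigma> = fst (snd \<sigma>) - fst (fst \<sigma>) + snd (snd (snd \<sigma>)) - sqrt (2 * h) *\<^sub>R fst (snd (snd \<sigma>))"

lemma measurable_coupling_error [measurable]: "coupling_error h \<in> borel_measurable state_space"
  unfolding coupling_error_def by measurable

text \<open>The rejections enter through their conditional mean, of order \<open>h^(3/2)\<close>, and their second
  moment, of order \<open>h^2\<close>.\<close>
lemma rejection_step:
  fixes \<rho> x z :: "real ^ 'n"
  assumes "0 < h" "h \<le> 1"
  defines "y \<equiv> proposal h x z"
  shows "accept h x y * (norm \<rho>)\<^sup>2 + (1 - accept h x y) * (norm (\<rho> + (x - y)))\<^sup>2
    \<le> (1 + h) * (norm \<rho>)\<^sup>2 + h\<^sup>2 * rejection_integrand x z"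
proof -
  define \<alpha> where "\<alpha> = 1 - accept h x y"
  define p where "p = norm (y - x)"
  define w where "w = norm (gradU x) + 2 * norm z"
  have \<alpha>: "\<alpha> \<ge> 0" "\<alpha> \<le> 1"
    using accept_bounds by (auto simp: \<alpha>_def)
  have p: "p \<ge> 0" "p \<le> sqrt h * w" and \<alpha>_le: "\<alpha> \<le> reject_const * h * w\<^sup>2"
    using proposal_distance[OF assms(1,2), of x z] rejection_bound[OF assms(1,2), of x z]
    by (auto simp: \<alpha>_def p_def w_def y_def proposal_def)
  have p2: "p\<^sup>2 \<le> h * w\<^sup>2"
    using power_mono[OF p(2,1), of 2] assms(1) by (simp add: power_mult_distrib)
  have 1: "\<alpha> * p\<^sup>2 \<le> h\<^sup>2 * (reject_const * w ^ 4)"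
  proof -
    have "\<alpha> * p\<^sup>2 \<le> (reject_const * h * w\<^sup>2) * (h * w\<^sup>2)"
      using \<alpha> \<alpha>_le p2 by (intro mult_mono) auto
    also have "\<dots> = h\<^sup>2 * (reject_const * w ^ 4)"
      by (simp add: power2_eq_square power4_eq_xxxx mult_ac)
    finally show ?thesis .
  qed
  have 2: "(\<alpha> * p)\<^sup>2 / h \<le> h\<^sup>2 * (reject_const\<^sup>2 * w ^ 6)"
  proof -
    have "\<alpha>\<^sup>2 * p\<^sup>2 \<le> (reject_const * h * w\<^sup>2)\<^sup>2 * (h * w\<^sup>2)"
      using \<alpha> \<alpha>_le p2 by (intro mult_mono power_mono) auto
    also have "\<dots> = h * (h\<^sup>2 * (reject_const\<^sup>2 * w ^ 6))"
      by (simp add: power_mult_distrib mult_ac flip: power_mult power_add)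
    finally show ?thesis
      using assms(1) by (simp add: power_mult_distrib divide_le_eq mult_ac)
  qed
  \<comment> \<open>Young's inequality with weight \<open>h\<close>: the resulting growth factor
    \<open>1 + h\<close> stays bounded over \<gamma> / h steps.\<close>
  have 3: "2 * (\<alpha> * p) * norm \<rho> \<le> h * (norm \<rho>)\<^sup>2 + (\<alpha> * p)\<^sup>2 / h"
  proof -
    have "h * (norm \<rho>)\<^sup>2 + (\<alpha> * p)\<^sup>2 / h - 2 * (\<alpha> * p) * norm \<rho> = (h * norm \<rho> - \<alpha> * p)\<^sup>2 / h"
      using assms(1) by (simp add: field_simps power2_eq_square)
    moreover have "(h * norm \<rho> - \<alpha> * p)\<^sup>2 / h \<ge> 0"
      using assms(1) by simp
    ultimately show ?thesis by linarith
  qed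
  have "(norm (\<rho> + (x - y)))\<^sup>2 \<le> (norm \<rho> + p)\<^sup>2"
    using norm_triangle_ineq[of \<rho> "x - y"] by (intro power_mono) (auto simp: p_def norm_minus_commute)
  then have "\<alpha> * (norm (\<rho> + (x - y)))\<^sup>2 \<le> \<alpha> * (norm \<rho> + p)\<^sup>2"
    using \<alpha> by (intro mult_left_mono)
  then have "(1 - \<alpha>) * (norm \<rho>)\<^sup>2 + \<alpha> * (norm (\<rho> + (x - y)))\<^sup>2
      \<le> (norm \<rho>)\<^sup>2 + 2 * (\<alpha> * p) * norm \<rho> + \<alpha> * p\<^sup>2"
    by (simp add: power2_sum algebra_simps)
  also have "\<dots> \<le> (1 + h) * (norm \<rho>)\<^sup>2 + h\<^sup>2 * (reject_const\<^sup>2 * w ^ 6) + h\<^sup>2 * (reject_const * w ^ 4)"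
    using 1 2 3 by (simp add: distrib_right)
  finally show ?thesis
    by (simp add: \<alpha>_def rejection_integrand_def w_def distrib_left)
qed

lemma coupling_error_update:
  "(\<integral>\<^sup>+\<omega>. ennreal ((norm (coupling_error h (update h \<sigma> \<omega>)))\<^sup>2) \<partial>mala_noise)
    = (\<integral>\<^sup>+z. (let x = fst (snd \<sigma>); y = proposal h x z; \<rho> = coupling_error h \<sigma> in
        ennreal (accept h x y * (norm \<rho>)\<^sup>2 + (1 - accept h x y) * (norm (\<rho> + (x - y)))\<^sup>2)) \<partial>isotropic_gaussian 0 1)"
proof -
  define x where "x = fst (snd \<sigma>)"
  define \<rho> where "\<rho> = coupling_error h \<sigma>"
  define \<phi> where "\<phi> z x' = ennreal ((norm (\<rho> + x' - proposal h x z))\<^sup>2)" for z x'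
  have [measurable]: "case_prod \<phi> \<in> borel_measurable (borel \<Otimes>\<^sub>M borel)"
    unfolding \<phi>_def by measurable
  have "coupling_error h (update h \<sigma> \<omega>) = \<rho> + mala_step h x \<omega> - proposal h x (fst \<omega>)" for \<omega>
    by (simp add: coupling_error_def \<rho>_def x_def proposal_def algebra_simps)
  then have "(\<integral>\<^sup>+\<omega>. ennreal ((norm (coupling_error h (update h \<sigma> \<omega>)))\<^sup>2) \<partial>mala_noise)
      = (\<integral>\<^sup>+\<omega>. \<phi> (fst \<omega>) (mala_step h x \<omega>) \<partial>mala_noise)"
    by (simp add: \<phi>_def)
  also have "\<dots> = (\<integral>\<^sup>+z. ennreal (accept h x (proposal h x z)) * \<phi> z (proposal h x z)
          + ennreal (1 - accept h x (proposal h x z)) * \<phi> z x \<partial>isotropic_gaussian 0 1)"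
    by (rule nn_integral_mala_noise_step) measurable
  finally show ?thesis
    using accept_bounds
    by (simp add: \<phi>_def Let_def x_def \<rho>_def ennreal_mult add_diff_eq flip: ennreal_plus ennreal_mult)
qed

section \<open>Laws and second moments along the coupled chain\<close>

context
  fixes \<zeta> :: "((real ^ 'n) \<times> (real ^ 'n)) measure" and h :: real
  assumes sets_\<zeta> [simp, measurable_cong]: "sets \<zeta> = sets (borel \<Otimes>\<^sub>M borel)"
    and marginal: "distr \<zeta> borel fst = gibbs_measure U"
    and h_pos: "h > 0" and h_le: "h \<le> 1"
begin

text \<open>Total mass 1 is not part of the definition of \<open>couplings\<close>; it is inherited
  from the marginal.\<close>

lemma prob_space_coupling: "prob_space \<zeta>"
proof -
  have "prob_space (distr \<zeta> borel fst)"
    using prob_space_gibbs by (simp add: marginal)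
  then show ?thesis
    by (rule prob_space_distrD[rotated]) measurable
qed

lemma chain_initial:
  assumes [measurable]: "\<phi> \<in> borel_measurable (borel \<Otimes>\<^sub>M borel)"
  shows "(\<integral>\<^sup>+\<sigma>. \<phi> (fst \<sigma>) \<partial>chain h \<zeta> k) = (\<integral>\<^sup>+p. \<phi> p \<partial>\<zeta>)"
proof (induction k)
  case 0
  show ?case by (simp add: nn_integral_distr)
next
  case (Suc k)
  have "(\<integral>\<^sup>+\<sigma>. \<phi> (fst \<sigma>) \<partial>chain h \<zeta> (Suc k)) = (\<integral>\<^sup>+\<sigma>. \<phi> (fst \<sigma>) \<partial>chain h \<zeta> k)"
    by (rule nn_integral_chain_Suc_const) simp_all
  with Suc show ?case by simp
qed

text \<open>The induction generalises over \<open>\<phi>\<close> because its hypothesis is applied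
  to the mean of \<open>\<phi>\<close> after one Metropolis step.\<close>

lemma chain_current:
  assumes [measurable]: "\<phi> \<in> borel_measurable borel"
  shows "(\<integral>\<^sup>+\<sigma>. \<phi> (fst (snd \<sigma>)) \<partial>chain h \<zeta> k) = (\<integral>\<^sup>+x. \<phi> x \<partial>gibbs_measure U)"
  using assms
proof (induction k arbitrary: \<phi>)
  case 0
  note [measurable] = 0
  show ?case by (simp add: nn_integral_distr flip: marginal)
next
  case (Suc k)
  note [measurable] = Suc.prems
  interpret V: prob_space mala_noise
    by (rule prob_space_mala_noise)
  have "(\<integral>\<^sup>+\<sigma>. \<phi> (fst (snd \<sigma>)) \<partial>chain h \<zeta> (Suc k))
      = (\<integral>\<^sup>+\<sigma>. \<integral>\<^sup>+\<omega>. \<phi> (mala_step h (fst (snd \<sigma>)) \<omega>) \<partial>mala_noise \<partial>chain h \<zeta> k)"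
    by (subst nn_integral_chain_Suc) simp_all
  also have "\<dots> = (\<integral>\<^sup>+x. \<integral>\<^sup>+\<omega>. \<phi> (mala_step h x \<omega>) \<partial>mala_noise \<partial>gibbs_measure U)"
    by (rule Suc.IH) measurable
  also have "\<dots> = (\<integral>\<^sup>+x. \<phi> x \<partial>gibbs_measure U)"
    using h_pos Suc.prems by (rule mala_step_invariant)
  finally show ?case .
qed

text \<open>The summed increments are independent of the second initial point, though not of the
  Metropolis chain. This is the independence that an Euler step from that point requires.\<close>

lemma chain_noise:
  assumes [measurable]: "case_prod \<phi> \<in> borel_measurable (borel \<Otimes>\<^sub>M borel)"
  shows "(\<integral>\<^sup>+\<sigma>. \<phi> (snd (fst \<sigma>)) (fst (snd (snd \<sigma>))) \<partial>chain h \<zeta> k)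
    = (\<integral>\<^sup>+y. \<integral>\<^sup>+s. \<phi> y s \<partial>noise_law k \<partial>distr \<zeta> borel snd)"
  using assms
proof (induction k arbitrary: \<phi>)
  case 0
  note [measurable] = 0
  show ?case
    by (simp add: nn_integral_distr noise_law_def nn_integral_return)
next
  case (Suc k)
  note [measurable] = Suc.prems
  interpret G: prob_space "isotropic_gaussian 0 1 :: (real ^ 'n) measure"
    by (rule prob_space_isotropic_gaussian) simp
  have "(\<integral>\<^sup>+\<sigma>. \<phi> (snd (fst \<sigma>)) (fst (snd (snd \<sigma>))) \<partial>chain h \<zeta> (Suc k))
      = (\<integral>\<^sup>+\<sigma>. \<integral>\<^sup>+\<omega>. \<phi> (snd (fst \<sigma>)) (fst (snd (snd \<sigma>)) + fst \<omega>) \<partial>mala_noise \<partial>chain h \<zeta> k)"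
    by (subst nn_integral_chain_Suc) simp_all
  also have "\<dots> = (\<integral>\<^sup>+\<sigma>. \<integral>\<^sup>+z. \<phi> (snd (fst \<sigma>)) (fst (snd (snd \<sigma>)) + z) \<partial>isotropic_gaussian 0 1 \<partial>chain h \<zeta> k)"
    by (intro nn_integral_cong nn_integral_mala_noise_fst) measurable
  also have "\<dots> = (\<integral>\<^sup>+y. \<integral>\<^sup>+s. \<integral>\<^sup>+z. \<phi> y (s + z) \<partial>isotropic_gaussian 0 1 \<partial>noise_law k \<partial>distr \<zeta> borel snd)"
    by (rule Suc.IH) measurable
  also have "\<dots> = (\<integral>\<^sup>+y. \<integral>\<^sup>+s. \<phi> y s \<partial>noise_law (Suc k) \<partial>distr \<zeta> borel snd)"
    by (intro nn_integral_cong noise_law_Suc) measurable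
  finally show ?case .
qed

lemma chain_noise_l2:
  "l2_bounded (chain h \<zeta> k) (\<lambda>\<sigma>. fst (snd (snd \<sigma>))) (sqrt (real k * CARD('n)))"
proof -
  interpret \<zeta>: prob_space \<zeta>
    by (rule prob_space_coupling)
  interpret Y: prob_space "distr \<zeta> borel snd"
    by (rule \<zeta>.prob_space_distr) measurable
  have "(\<integral>\<^sup>+\<sigma>. ennreal ((norm (fst (snd (snd \<sigma>))))\<^sup>2) \<partial>chain h \<zeta> k) = ennreal (real k * CARD('n))"
    using chain_noise[of "\<lambda>y s. ennreal ((norm s)\<^sup>2)" k] Y.emeasure_space_1
    by (simp add: noise_law_second_moment)
  then show ?thesis
    by (simp add: l2_bounded_def)
qed

lemma chain_gradU_l2:
  "l2_bounded (chain h \<zeta> k) (\<lambda>\<sigma>. gradU (fst (snd \<sigma>))) (sqrt (L * CARD('n)))"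
proof -
  have "(\<integral>\<^sup>+\<sigma>. ennreal ((norm (gradU (fst (snd \<sigma>))))\<^sup>2) \<partial>chain h \<zeta> k) \<le> ennreal (L * CARD('n))"
    using gradU_second_moment by (subst chain_current) auto
  then show ?thesis
    using L_pos by (simp add: l2_bounded_def)
qed

lemma chain_drift_l2:
  "l2_bounded (chain h \<zeta> k) (\<lambda>\<sigma>. snd (snd (snd \<sigma>))) (real k * h * sqrt (L * CARD('n)))"
proof (induction k)
  case 0
  show ?case by (simp add: l2_bounded_def nn_integral_distr)
next
  case (Suc k)
  have "l2_bounded (chain h \<zeta> k) (\<lambda>\<sigma>. snd (snd (snd \<sigma>)) + h *\<^sub>R gradU (fst (snd \<sigma>)))
      (real k * h * sqrt (L * CARD('n)) + h * sqrt (L * CARD('n)))"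
    using h_pos by (intro l2_bounded_add Suc l2_bounded_scaleR chain_gradU_l2) auto
  then have "l2_bounded (chain h \<zeta> (Suc k)) (\<lambda>\<sigma>. snd (snd (snd \<sigma>)))
      (real k * h * sqrt (L * CARD('n)) + h * sqrt (L * CARD('n)))"
    by (rule l2_bounded_chain_Suc) simp_all
  then show ?case
    by (simp add: algebra_simps)
qed

text \<open>The current point always has the Gibbs law, so the rejection term integrates to the same
  constant at every step.\<close>

lemma chain_error_step:
  "(\<integral>\<^sup>+\<sigma>. ennreal ((norm (coupling_error h \<sigma>))\<^sup>2) \<partial>chain h \<zeta> (Suc k))
    \<le> ennreal (1 + h) * (\<integral>\<^sup>+\<sigma>. ennreal ((norm (coupling_error h \<sigma>))\<^sup>2) \<partial>chain h \<zeta> k)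
      + ennreal (h\<^sup>2) * rejection_total"
proof -
  interpret G: prob_space "isotropic_gaussian 0 1 :: (real ^ 'n) measure"
    by (rule prob_space_isotropic_gaussian) simp
  have nonneg: "rejection_integrand x z \<ge> 0" for x z
    using reject_const_nonneg by (simp add: rejection_integrand_def)
  have "(\<integral>\<^sup>+\<sigma>. ennreal ((norm (coupling_error h \<sigma>))\<^sup>2) \<partial>chain h \<zeta> (Suc k))
     = (\<integral>\<^sup>+\<sigma>. \<integral>\<^sup>+\<omega>. ennreal ((norm (coupling_error h (update h \<sigma> \<omega>)))\<^sup>2) \<partial>mala_noise \<partial>chain h \<zeta> k)"
    by (rule nn_integral_chain_Suc) measurable
  also have "\<dots> \<le> (\<integral>\<^sup>+\<sigma>. \<integral>\<^sup>+z. ennreal (1 + h) * ennreal ((norm (coupling_error h \<sigma>))\<^sup>2)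
      + ennreal (h\<^sup>2) * ennreal (rejection_integrand (fst (snd \<sigma>)) z) \<partial>isotropic_gaussian 0 1 \<partial>chain h \<zeta> k)"
    unfolding coupling_error_update Let_def
    using rejection_step[OF h_pos h_le] nonneg h_pos
    by (intro nn_integral_mono) (auto intro!: ennreal_leI simp flip: ennreal_mult ennreal_plus)
  also have "\<dots> = (\<integral>\<^sup>+\<sigma>. ennreal (1 + h) * ennreal ((norm (coupling_error h \<sigma>))\<^sup>2)
      + ennreal (h\<^sup>2) * (\<integral>\<^sup>+z. ennreal (rejection_integrand (fst (snd \<sigma>)) z) \<partial>isotropic_gaussian 0 1) \<partial>chain h \<zeta> k)"
    using G.emeasure_space_1 by (simp add: nn_integral_add nn_integral_cmult)
  also have "\<dots> = ennreal (1 + h) * (\<integral>\<^sup>+\<sigma>. ennreal ((norm (coupling_error h \<sigma>))\<^sup>2) \<partial>chain h \<zeta> k)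
      + ennreal (h\<^sup>2) * (\<integral>\<^sup>+\<sigma>. \<integral>\<^sup>+z. ennreal (rejection_integrand (fst (snd \<sigma>)) z) \<partial>isotropic_gaussian 0 1 \<partial>chain h \<zeta> k)"
    by (simp add: nn_integral_add nn_integral_cmult)
  also have "(\<integral>\<^sup>+\<sigma>. \<integral>\<^sup>+z. ennreal (rejection_integrand (fst (snd \<sigma>)) z) \<partial>isotropic_gaussian 0 1 \<partial>chain h \<zeta> k) = rejection_total"
    unfolding rejection_total_def by (rule chain_current) measurable
  finally show ?thesis .
qed

text \<open>A discrete Gronwall argument that grants each of the \<open>k\<close> contributions the
  full growth. With \<open>k\<close> at most \<open>N\<close> and \<open>N * h\<close> fixed, one
  factor \<open>h\<close> survives, so the error vanishes with the step size.\<close>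

lemma chain_error_bound:
  "(\<integral>\<^sup>+\<sigma>. ennreal ((norm (coupling_error h \<sigma>))\<^sup>2) \<partial>chain h \<zeta> k)
    \<le> ennreal (enn2real rejection_total * h\<^sup>2 * real k * (1 + h) ^ k)"
proof (induction k)
  case 0
  show ?case by (simp add: nn_integral_distr coupling_error_def)
next
  case (Suc k)
  define C where "C = enn2real rejection_total"
  have C: "C \<ge> 0" "rejection_total = ennreal C"
    using rejection_total_finite by (auto simp: C_def)
  have "(\<integral>\<^sup>+\<sigma>. ennreal ((norm (coupling_error h \<sigma>))\<^sup>2) \<partial>chain h \<zeta> (Suc k))
      \<le> ennreal (1 + h) * (\<integral>\<^sup>+\<sigma>. ennreal ((norm (coupling_error h \<sigma>))\<^sup>2) \<partial>chain h \<zeta> k)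
        + ennreal (h\<^sup>2) * ennreal C"
    unfolding C(2)[symmetric] by (rule chain_error_step)
  also have "\<dots> \<le> ennreal (1 + h) * ennreal (C * h\<^sup>2 * real k * (1 + h) ^ k) + ennreal (h\<^sup>2) * ennreal C"
    using Suc.IH by (intro add_right_mono mult_left_mono) (auto simp: C_def)
  also have "\<dots> = ennreal (C * h\<^sup>2 * (real k * (1 + h) ^ Suc k + 1))"
    using C h_pos by (simp add: algebra_simps flip: ennreal_mult ennreal_plus)
  also have "\<dots> \<le> ennreal (C * h\<^sup>2 * (real k * (1 + h) ^ Suc k + (1 + h) ^ Suc k))"
    using C h_pos by (intro ennreal_leI mult_left_mono add_left_mono one_le_power) auto
  finally show ?case
    by (simp add: C_def algebra_simps)
qed

lemma chain_error_l2:
  assumes "k \<le> N"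
  shows "l2_bounded (chain h \<zeta> k) (coupling_error h)
    (sqrt (enn2real rejection_total * h * (real N * h) * exp (real N * h)))"
proof -
  have "(1 + h) ^ k \<le> exp (real N * h)"
  proof -
    have "(1 + h) ^ k \<le> exp h ^ k"
      using h_pos by (intro power_mono) auto
    also have "\<dots> = exp (real k * h)"
      by (simp add: exp_of_nat_mult)
    also have "\<dots> \<le> exp (real N * h)"
      using assms h_pos by simp
    finally show ?thesis .
  qed
  then have "enn2real rejection_total * h\<^sup>2 * (real k * (1 + h) ^ k)
      \<le> enn2real rejection_total * h\<^sup>2 * (real N * exp (real N * h))"
    using assms h_pos by (intro mult_left_mono mult_mono) auto
  then have "ennreal (enn2real rejection_total * h\<^sup>2 * real k * (1 + h) ^ k)
      \<le> ennreal (enn2real rejection_total * h * (real N * h) * exp (real N * h))"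
    by (intro ennreal_leI) (simp add: power2_eq_square mult_ac)
  then show ?thesis
    using order_trans[OF chain_error_bound] h_pos by (simp add: l2_bounded_def)
qed

text \<open>The definition of \<open>coupling_error\<close> is solved for the displacement;
  rejection error, drift and noise are then bounded separately.\<close>

lemma chain_displacement_l2:
  assumes "l2_bounded (chain h \<zeta> k) (coupling_error h) R"
  shows "l2_bounded (chain h \<zeta> k) (\<lambda>\<sigma>. fst (snd \<sigma>) - fst (fst \<sigma>))
    (R + real k * h * sqrt (L * CARD('n)) + sqrt (2 * h) * sqrt (real k * CARD('n)))"
proof -
  have "l2_bounded (chain h \<zeta> k)
      (\<lambda>\<sigma>. coupling_error h \<sigma> - snd (snd (snd \<sigma>)) + sqrt (2 * h) *\<^sub>R fst (snd (snd \<sigma>)))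
      (R + real k * h * sqrt (L * CARD('n)) + sqrt (2 * h) * sqrt (real k * CARD('n)))"
    using h_pos
    by (intro l2_bounded_add l2_bounded_diff l2_bounded_scaleR assms chain_drift_l2 chain_noise_l2) auto
  then show ?thesis
    by (simp add: coupling_error_def)
qed

text \<open>Freezing the gradient at the initial point costs, in each step, \<open>h * L\<close>
  times the displacement reached so far. The triangle inequality over the steps is good enough here,
  since \<open>h\<close> is already a factor of each summand.\<close>

lemma chain_drift_error_l2:
  assumes "\<And>j. j < k \<Longrightarrow> l2_bounded (chain h \<zeta> j) (coupling_error h) R"
  shows "l2_bounded (chain h \<zeta> k) (\<lambda>\<sigma>. snd (snd (snd \<sigma>)) - (real k * h) *\<^sub>R gradU (fst (fst \<sigma>)))
    (\<Sum>j<k. h * (L * (R + real j * h * sqrt (L * CARD('n)) + sqrt (2 * h) * sqrt (real j * CARD('n)))))"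
  using assms
proof (induction k)
  case 0
  show ?case by (simp add: l2_bounded_def nn_integral_distr)
next
  case (Suc k)
  let ?b = "\<lambda>j. h * (L * (R + real j * h * sqrt (L * CARD('n)) + sqrt (2 * h) * sqrt (real j * CARD('n))))"
  have "l2_bounded (chain h \<zeta> k)
     (\<lambda>\<sigma>. (snd (snd (snd \<sigma>)) - (real k * h) *\<^sub>R gradU (fst (fst \<sigma>)))
        + h *\<^sub>R (gradU (fst (snd \<sigma>)) - gradU (fst (fst \<sigma>)))) ((\<Sum>j<k. ?b j) + ?b k)"
  proof (intro l2_bounded_add l2_bounded_scaleR)
    show "l2_bounded (chain h \<zeta> k) (\<lambda>\<sigma>. gradU (fst (snd \<sigma>)) - gradU (fst (fst \<sigma>)))
      (L * (R + real k * h * sqrt (L * CARD('n)) + sqrt (2 * h) * sqrt (real k * CARD('n))))"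
      using L_pos by (intro l2_bounded_lipschitz[OF chain_displacement_l2] Suc.prems lipschitz) auto
  qed (use Suc h_pos in auto)
  then have "l2_bounded (chain h \<zeta> (Suc k)) (\<lambda>\<sigma>. snd (snd (snd \<sigma>)) - (real (Suc k) * h) *\<^sub>R gradU (fst (fst \<sigma>)))
      ((\<Sum>j<k. ?b j) + ?b k)"
    by (rule l2_bounded_chain_Suc) (simp_all add: algebra_simps)
  then show ?case by simp
qed

lemma drift_error_sum_le:
  assumes "R \<ge> 0" "\<gamma> = real N * h"
  shows "(\<Sum>j<N. h * (L * (R + real j * h * sqrt (L * CARD('n)) + sqrt (2 * h) * sqrt (real j * CARD('n)))))
    \<le> L * (\<gamma> * R + \<gamma>\<^sup>2 / 2 * sqrt (L * CARD('n)) + \<gamma> * sqrt (\<gamma> * CARD('n)))"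
proof -
  let ?G = "sqrt (L * CARD('n))"
  have "(\<Sum>j<N. h * (L * (R + real j * h * ?G + sqrt (2 * h) * sqrt (real j * CARD('n)))))
     = L * (real N * h * R + h\<^sup>2 * (\<Sum>j<N. real j) * ?G + h * sqrt (2 * h * CARD('n)) * (\<Sum>j<N. sqrt (real j)))"
    by (simp add: sum.distrib sum_distrib_left sum_distrib_right algebra_simps power2_eq_square real_sqrt_mult)
  also have "\<dots> \<le> L * (real N * h * R + h\<^sup>2 * ((real N)\<^sup>2 / 2) * ?G + h * sqrt (2 * h * CARD('n)) * (real N * sqrt (real N / 2)))"
  proof -
    have "(\<Sum>j<N. real j) \<le> (real N)\<^sup>2 / 2"
      by (induction N) (auto simp: power2_eq_square field_simps)
    then show ?thesis
      using L_pos h_pos sum_sqrt_le[of N]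
      by (intro mult_left_mono add_mono mult_right_mono) auto
  qed
  also have "\<dots> = L * (\<gamma> * R + \<gamma>\<^sup>2 / 2 * ?G + \<gamma> * sqrt (\<gamma> * CARD('n)))"
    unfolding assms(2)
    by (simp add: power_mult_distrib real_sqrt_mult real_sqrt_divide algebra_simps)
  finally show ?thesis .
qed

lemma chain_euler_distance:
  assumes "l2_bounded \<zeta> (\<lambda>p. fst p - snd p) q" and "\<gamma> = real N * h" "\<gamma> > 0" "\<gamma> * (m + L) \<le> 1"
  defines "R \<equiv> sqrt (enn2real rejection_total * h * \<gamma> * exp \<gamma>)"
  shows "l2_bounded (chain h \<zeta> N)
    (\<lambda>\<sigma>. fst (snd \<sigma>) - (snd (fst \<sigma>) - \<gamma> *\<^sub>R gradU (snd (fst \<sigma>)) + sqrt (2 * h) *\<^sub>R fst (snd (snd \<sigma>))))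
    ((1 - \<gamma> * m) * q + R + L * (\<gamma> * R + \<gamma>\<^sup>2 / 2 * sqrt (L * CARD('n)) + \<gamma> * sqrt (\<gamma> * CARD('n))))"
proof -
  have error: "l2_bounded (chain h \<zeta> j) (coupling_error h) R" if "j \<le> N" for j
    using chain_error_l2[OF that] by (simp add: R_def assms(2))
  have R: "R \<ge> 0"
    using error[of 0] l2_boundedD_nonneg by auto
  have \<gamma>m: "\<gamma> * m \<le> 1"
    using assms(3,4) L_pos by (smt (verit) distrib_left mult_pos_pos)
  have q: "q \<ge> 0"
    using assms(1) by (rule l2_boundedD_nonneg)
  have initial: "l2_bounded (chain h \<zeta> N) (\<lambda>\<sigma>. fst (fst \<sigma>) - snd (fst \<sigma>)) q"
    using assms(1) chain_initial[of "\<lambda>p. ennreal ((norm (fst p - snd p))\<^sup>2)"] by (simp add: l2_bounded_def)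
  have contraction: "l2_bounded (chain h \<zeta> N)
     (\<lambda>\<sigma>. (fst (fst \<sigma>) - \<gamma> *\<^sub>R gradU (fst (fst \<sigma>))) - (snd (fst \<sigma>) - \<gamma> *\<^sub>R gradU (snd (fst \<sigma>)))) ((1 - \<gamma> * m) * q)"
    using \<gamma>m by (intro l2_bounded_lipschitz[OF initial] gradient_step_contraction assms(3,4)) auto
  have drift: "l2_bounded (chain h \<zeta> N) (\<lambda>\<sigma>. snd (snd (snd \<sigma>)) - \<gamma> *\<^sub>R gradU (fst (fst \<sigma>)))
     (L * (\<gamma> * R + \<gamma>\<^sup>2 / 2 * sqrt (L * CARD('n)) + \<gamma> * sqrt (\<gamma> * CARD('n))))"
    using l2_bounded_mono[OF chain_drift_error_l2[of N R] drift_error_sum_le[OF R assms(2)]] error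
    by (simp add: assms(2))
  have "l2_bounded (chain h \<zeta> N)
     (\<lambda>\<sigma>. ((fst (fst \<sigma>) - \<gamma> *\<^sub>R gradU (fst (fst \<sigma>))) - (snd (fst \<sigma>) - \<gamma> *\<^sub>R gradU (snd (fst \<sigma>)))
         + coupling_error h \<sigma>) - (snd (snd (snd \<sigma>)) - \<gamma> *\<^sub>R gradU (fst (fst \<sigma>))))
     ((1 - \<gamma> * m) * q + R + L * (\<gamma> * R + \<gamma>\<^sup>2 / 2 * sqrt (L * CARD('n)) + \<gamma> * sqrt (\<gamma> * CARD('n))))"
    by (intro l2_bounded_diff l2_bounded_add contraction drift error) auto
  then show ?thesis
    by (simp add: coupling_error_def algebra_simps)
qed

end

end

subsection \<open>The Wasserstein bound\<close>

text \<open>Without truncation the drift inequality would say nothing if the mean of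
  \<open>V\<close> were infinite. At level \<open>M\<close> the mean of \<open>min (V x) M\<close>
  is finite and can be cancelled, which leaves the bound \<open>b / a\<close> for truncations of
  \<open>V\<close>, uniformly in \<open>M\<close>; monotone convergence then applies.\<close>

lemma second_moment_finite_if_drift:
  fixes V :: "'a \<Rightarrow> real"
  assumes "prob_space \<mu>" and [measurable]: "V \<in> borel_measurable \<mu>" and V: "\<And>x. V x \<ge> 0"
    and a: "0 < a" "a \<le> 1" and b: "b \<ge> 0"
    and drift: "\<And>M. M > 0 \<Longrightarrow>
      (\<integral>\<^sup>+x. ennreal (min (V x) M) \<partial>\<mu>) \<le> (\<integral>\<^sup>+x. ennreal (min ((1 - a) * V x + b) M) \<partial>\<mu>)"
  shows "(\<integral>\<^sup>+x. ennreal (V x) \<partial>\<mu>) < \<infinity>"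
proof -
  interpret prob_space \<mu> by fact
  \<comment> \<open>Above the level the truncation drops to 0 rather than to the level: there the
    two minima leave no room for an additional \<open>a * V x\<close>.\<close>
  define W where "W n x = (if V x \<le> real (Suc n) then V x else 0)" for n x
  have [measurable]: "W n \<in> borel_measurable \<mu>" for n
    unfolding W_def by measurable
  have W: "W n x \<ge> 0" for n x
    using V by (simp add: W_def)
  have bound: "ennreal a * (\<integral>\<^sup>+x. ennreal (W n x) \<partial>\<mu>) \<le> ennreal b" for n
  proof -
    define M where "M = real (Suc n)"
    have M: "M > 0" by (simp add: M_def)
    let ?I = "\<integral>\<^sup>+x. ennreal (min (V x) M) \<partial>\<mu>"
    have "?I \<le> (\<integral>\<^sup>+x. ennreal M \<partial>\<mu>)"
      by (intro nn_integral_mono ennreal_leI) simp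
    then have finite: "?I < \<top>"
      using emeasure_space_1 by (simp add: order_le_less_trans)
    have "?I + ennreal a * (\<integral>\<^sup>+x. ennreal (W n x) \<partial>\<mu>)
        \<le> (\<integral>\<^sup>+x. ennreal (min ((1 - a) * V x + b) M) \<partial>\<mu>) + ennreal a * (\<integral>\<^sup>+x. ennreal (W n x) \<partial>\<mu>)"
      by (intro add_right_mono drift M)
    also have "\<dots> = (\<integral>\<^sup>+x. ennreal (min ((1 - a) * V x + b) M) + ennreal a * ennreal (W n x) \<partial>\<mu>)"
      by (simp add: nn_integral_add nn_integral_cmult)
    also have "\<dots> \<le> (\<integral>\<^sup>+x. ennreal (min (V x) M) + ennreal b \<partial>\<mu>)"
    proof (intro nn_integral_mono)
      fix x
      have "(1 - a) * V x + a * V x = V x"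
        by (simp add: algebra_simps)
      then have "min ((1 - a) * V x + b) M + a * W n x \<le> min (V x) M + b"
        using b M by (auto simp: W_def M_def min_def)
      moreover have "(1 - a) * V x \<ge> 0"
        using a V by simp
      ultimately show "ennreal (min ((1 - a) * V x + b) M) + ennreal a * ennreal (W n x)
          \<le> ennreal (min (V x) M) + ennreal b"
        using a b V[of x] W[of n x] M by (simp add: ennreal_leI flip: ennreal_plus ennreal_mult)
    qed
    also have "\<dots> = ?I + ennreal b"
      using emeasure_space_1 by (simp add: nn_integral_add)
    finally show ?thesis
      using finite by (auto simp: ennreal_add_left_cancel_le)
  qed
  have "incseq (\<lambda>n x. ennreal (W n x))"
    using V by (auto simp: incseq_def le_fun_def W_def intro!: ennreal_leI)
  then have "(\<integral>\<^sup>+x. (SUP n. ennreal (W n x)) \<partial>\<mu>) = (SUP n. \<integral>\<^sup>+x. ennreal (W n x) \<partial>\<mu>)"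
    by (intro nn_integral_monotone_convergence_SUP) measurable
  moreover have "(SUP n. ennreal (W n x)) = ennreal (V x)" for x
  proof (rule antisym)
    show "(SUP n. ennreal (W n x)) \<le> ennreal (V x)"
      using V by (intro SUP_least ennreal_leI) (simp add: W_def)
    obtain n where "V x \<le> real n"
      using real_arch_simple by blast
    then have "W n x = V x"
      by (simp add: W_def)
    then show "ennreal (V x) \<le> (SUP n. ennreal (W n x))"
      by (metis SUP_upper UNIV_I)
  qed
  ultimately have "(\<integral>\<^sup>+x. ennreal (V x) \<partial>\<mu>) = (SUP n. \<integral>\<^sup>+x. ennreal (W n x) \<partial>\<mu>)"
    by simp
  also have "\<dots> \<le> ennreal (b / a)"
  proof (rule SUP_least)
    fix n
    have "ennreal (1 / a) * (ennreal a * (\<integral>\<^sup>+x. ennreal (W n x) \<partial>\<mu>)) \<le> ennreal (1 / a) * ennreal b"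
      by (intro mult_left_mono bound) simp
    then show "(\<integral>\<^sup>+x. ennreal (W n x) \<partial>\<mu>) \<le> ennreal (b / a)"
      using a b by (simp flip: ennreal_mult mult.assoc)
  qed
  finally show ?thesis
    by (simp add: order_le_less_trans)
qed

lemma ennreal_sqrt_power2: "(ennreal_sqrt x)\<^sup>2 = x"
proof (cases x)
  case (real r)
  then show ?thesis
    by (simp add: ennreal_sqrt_def ennreal_power)
next
  case top
  then show ?thesis
    by (simp add: ennreal_sqrt_def power2_eq_square)
qed

text \<open>With \<open>sqrt (\<gamma> * d)\<close> taken out, only
  \<open>v = sqrt (L * \<gamma>)\<close> and \<open>r = m / L\<close> matter. The factor
  \<open>(1 + r)\<^sup>2 / m\<^sup>2\<close> is \<open>4 * (inverse \<kappa>)\<^sup>2\<close>, and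
  the right-hand side exceeds what is needed by nonnegative terms.\<close>

lemma wasserstein_bound_le:
  fixes L m \<gamma> d :: real
  assumes "m > 0" "L > 0" "\<gamma> > 0" "d \<ge> 0"
  defines "\<kappa> \<equiv> 2 * m * L / (m + L)"
  shows "(L / m * (\<gamma> / 2 * sqrt (L * d) + sqrt (\<gamma> * d)))\<^sup>2
    \<le> 2 * inverse \<kappa> * L\<^sup>2 * \<gamma> * (inverse \<kappa> + \<gamma>) * (2 * d + d * L\<^sup>2 * \<gamma> / m + d * L\<^sup>2 * \<gamma>\<^sup>2 / 6)"
proof -
  define v where "v = sqrt (L * \<gamma>)"
  define r where "r = m / L"
  have v: "v \<ge> 0" "v\<^sup>2 = L * \<gamma>" and r: "r > 0"
    using assms by (auto simp: v_def r_def)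
  have "\<gamma> * sqrt (L * d) = sqrt (\<gamma> * d) * v"
  proof -
    have "sqrt (\<gamma> * d) * v = sqrt (\<gamma>\<^sup>2 * (L * d))"
      by (simp add: v_def power2_eq_square mult_ac flip: real_sqrt_mult)
    also have "\<dots> = \<gamma> * sqrt (L * d)"
      using assms(3) by (simp add: real_sqrt_mult)
    finally show ?thesis
      by (rule sym)
  qed
  then have sum: "\<gamma> / 2 * sqrt (L * d) + sqrt (\<gamma> * d) = sqrt (\<gamma> * d) * (1 + v / 2)"
    by (simp add: algebra_simps)
  have lhs: "(L / m * (\<gamma> / 2 * sqrt (L * d) + sqrt (\<gamma> * d)))\<^sup>2 = L\<^sup>2 * \<gamma> * d / m\<^sup>2 * (1 + v / 2)\<^sup>2"
    unfolding sum using assms by (simp add: power_mult_distrib power_divide)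
  \<comment> \<open>The weight \<open>2 * r\<close> is chosen to make
    \<open>v\<^sup>2 / (2 * r)\<close> equal to \<open>L\<^sup>2 * \<gamma> / (2 * m)\<close>, the
    correction in the target, while \<open>1 + 2 * r\<close> still fits under
    \<open>(1 + r)\<^sup>2\<close>.\<close>
  have amgm: "(1 + v / 2)\<^sup>2 \<le> (1 + 2 * r) * (1 + v\<^sup>2 / (2 * r))"
  proof -
    have "2 * r + v\<^sup>2 / (2 * r) - 2 * v = (2 * r - v)\<^sup>2 / (2 * r)"
      using r by (simp add: field_simps power2_eq_square)
    moreover have "(2 * r - v)\<^sup>2 / (2 * r) \<ge> 0"
      using r by simp
    moreover have "(1 + 2 * r) * (1 + v\<^sup>2 / (2 * r)) = 1 + (2 * r + v\<^sup>2 / (2 * r)) + v\<^sup>2"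
      using r by (simp add: field_simps power2_eq_square)
    moreover have "(1 + v / 2)\<^sup>2 = 1 + v + v\<^sup>2 / 4"
      by (simp add: power2_eq_square algebra_simps)
    ultimately show ?thesis
      using v(1) zero_le_power2[of v] by linarith
  qed
  have vr: "v\<^sup>2 / (2 * r) = L\<^sup>2 * \<gamma> / (2 * m)"
    unfolding v(2) r_def using assms by (simp add: power2_eq_square field_simps)
  have \<kappa>: "inverse \<kappa> > 0" "4 * (inverse \<kappa>)\<^sup>2 = (1 + r)\<^sup>2 / m\<^sup>2"
    using assms by (auto simp: \<kappa>_def r_def power_divide power_mult_distrib field_simps)
  have "L\<^sup>2 * \<gamma> * d / m\<^sup>2 * (1 + v / 2)\<^sup>2 \<le> L\<^sup>2 * \<gamma> * d / m\<^sup>2 * ((1 + r)\<^sup>2 * (1 + L\<^sup>2 * \<gamma> / (2 * m)))"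
  proof (intro mult_left_mono)
    have "(1 + 2 * r) * (1 + L\<^sup>2 * \<gamma> / (2 * m)) \<le> (1 + r)\<^sup>2 * (1 + L\<^sup>2 * \<gamma> / (2 * m))"
      using assms by (intro mult_right_mono) (auto simp: power2_eq_square algebra_simps)
    then show "(1 + v / 2)\<^sup>2 \<le> (1 + r)\<^sup>2 * (1 + L\<^sup>2 * \<gamma> / (2 * m))"
      using amgm unfolding vr by linarith
  qed (use assms in auto)
  also have "\<dots> = L\<^sup>2 * \<gamma> * d * (1 + L\<^sup>2 * \<gamma> / (2 * m)) * ((1 + r)\<^sup>2 / m\<^sup>2)"
    by simp
  also have "\<dots> = 2 * inverse \<kappa> * L\<^sup>2 * \<gamma> * inverse \<kappa> * (2 * d + d * L\<^sup>2 * \<gamma> / m)"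
  proof -
    have "2 * d + d * L\<^sup>2 * \<gamma> / m = 2 * d * (1 + L\<^sup>2 * \<gamma> / (2 * m))"
      using assms(1) by (simp add: field_simps)
    then show ?thesis
      unfolding \<kappa>(2)[symmetric] by (simp only: power2_eq_square mult_ac)
  qed
  also have "\<dots> \<le> 2 * inverse \<kappa> * L\<^sup>2 * \<gamma> * (inverse \<kappa> + \<gamma>) * (2 * d + d * L\<^sup>2 * \<gamma> / m + d * L\<^sup>2 * \<gamma>\<^sup>2 / 6)"
    using assms(1-4) \<kappa>(1) by (intro mult_mono) auto
  finally show ?thesis
    unfolding lhs .
qed

context strongly_convex_potential
begin

section \<open>The Euler kernel and the second moment of its stationary law\<close>

lemma euler_kernel_eq:
  assumes "\<gamma> > 0"
  shows "euler_kernel gradU \<gamma> x = distr (isotropic_gaussian 0 1) borel (proposal \<gamma> x)"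
  using assms isotropic_gaussian_affine[of 1 "sqrt (2 * \<gamma>)" "x - \<gamma> *\<^sub>R gradU x"]
  by (simp add: euler_kernel_def proposal_def[abs_def])

context
  fixes \<mu> :: "(real ^ 'n) measure" and \<gamma> :: real
  assumes stationary: "stationary_distribution (euler_kernel gradU \<gamma>) \<mu>"
    and \<gamma>_pos: "\<gamma> > 0" and \<gamma>_le: "\<gamma> * (m + L) \<le> 1"
begin

lemma sets_\<mu> [simp, measurable_cong]: "sets \<mu> = sets borel"
  and prob_space_\<mu>: "prob_space \<mu>"
  using stationary by (auto simp: stationary_distribution_def)

lemma \<gamma>m: "0 < \<gamma> * m" "\<gamma> * m \<le> 1"
proof -
  show "0 < \<gamma> * m"
    using \<gamma>_pos m_pos by simp
  have "\<gamma> * L \<ge> 0"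
    using \<gamma>_pos L_pos by simp
  then show "\<gamma> * m \<le> 1"
    using \<gamma>_le by (simp add: distrib_left)
qed

text \<open>Stationarity is defined on sets only. Identifying the law of one Euler step with
  \<open>\<mu>\<close> as a measure extends it to all nonnegative integrands.\<close>

lemma nn_integral_stationary:
  assumes [measurable]: "\<phi> \<in> borel_measurable borel"
  shows "(\<integral>\<^sup>+x. \<integral>\<^sup>+z. \<phi> (proposal \<gamma> x z) \<partial>isotropic_gaussian 0 1 \<partial>\<mu>) = (\<integral>\<^sup>+x. \<phi> x \<partial>\<mu>)"
proof -
  interpret G: prob_space "isotropic_gaussian 0 1 :: (real ^ 'n) measure"
    by (rule prob_space_isotropic_gaussian) simp
  let ?G = "isotropic_gaussian 0 1 :: (real ^ 'n) measure"
  let ?F = "\<lambda>p. proposal \<gamma> (fst p) (snd p)"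
  have [measurable]: "?F \<in> borel_measurable (\<mu> \<Otimes>\<^sub>M ?G)"
    by measurable
  have sf: "sigma_finite_measure ?G"
    by unfold_locales
  have "distr (\<mu> \<Otimes>\<^sub>M ?G) borel ?F = \<mu>"
  proof (rule measure_eqI)
    fix A assume "A \<in> sets (distr (\<mu> \<Otimes>\<^sub>M ?G) borel ?F)"
    then have A [measurable]: "A \<in> sets borel" by simp
    have "emeasure (distr (\<mu> \<Otimes>\<^sub>M ?G) borel ?F) A = (\<integral>\<^sup>+y. indicator A y \<partial>distr (\<mu> \<Otimes>\<^sub>M ?G) borel ?F)"
      by simp
    also have "\<dots> = (\<integral>\<^sup>+x. \<integral>\<^sup>+z. indicator A (proposal \<gamma> x z) \<partial>?G \<partial>\<mu>)"
      using nn_integral_distr_pair[OF sf, of ?F \<mu> borel "indicator A"] by simp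
    also have "\<dots> = (\<integral>\<^sup>+x. emeasure (euler_kernel gradU \<gamma> x) A \<partial>\<mu>)"
    proof (intro nn_integral_cong)
      fix x
      have "(\<integral>\<^sup>+z. indicator A (proposal \<gamma> x z) \<partial>?G) = (\<integral>\<^sup>+y. indicator A y \<partial>distr ?G borel (proposal \<gamma> x))"
        by (subst nn_integral_distr) (auto simp: proposal_def)
      then show "(\<integral>\<^sup>+z. indicator A (proposal \<gamma> x z) \<partial>?G) = emeasure (euler_kernel gradU \<gamma> x) A"
        by (simp add: euler_kernel_eq[OF \<gamma>_pos])
    qed
    also have "\<dots> = emeasure \<mu> A"
      using stationary A by (simp add: stationary_distribution_def)
    finally show "emeasure (distr (\<mu> \<Otimes>\<^sub>M ?G) borel ?F) A = emeasure \<mu> A" .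
  qed simp
  then show ?thesis
    using nn_integral_distr_pair[OF sf, of ?F \<mu> borel \<phi>] by simp
qed

text \<open>With \<open>t = \<gamma> * m\<close>, contraction towards the image of 0 and convexity
  of the square give the factor \<open>1 - t\<close>; Young's inequality with weight
  \<open>t\<close> separates the noise at the cost of \<open>1 + t\<close>. The product
  \<open>1 - t\<^sup>2\<close> is still below one.\<close>

lemma norm_proposal_le:
  "(norm (proposal \<gamma> x z))\<^sup>2 \<le> (1 - (\<gamma> * m)\<^sup>2) * (norm x)\<^sup>2
     + ((1 + \<gamma> * m) * (\<gamma> * m) * (norm (gradU 0) / m)\<^sup>2 + (1 + 1 / (\<gamma> * m)) * (2 * \<gamma>) * (norm z)\<^sup>2)"
proof -
  define t where "t = \<gamma> * m"
  define c where "c = norm (gradU 0) / m"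
  define a where "a = norm (x - \<gamma> *\<^sub>R gradU x)"
  define b where "b = sqrt (2 * \<gamma>) * norm z"
  have t: "0 < t" "t \<le> 1"
    using \<gamma>m by (auto simp: t_def)
  have "a \<le> (1 - t) * norm x + norm (\<gamma> *\<^sub>R gradU 0)"
  proof -
    have "a \<le> norm ((x - \<gamma> *\<^sub>R gradU x) - (0 - \<gamma> *\<^sub>R gradU 0)) + norm (0 - \<gamma> *\<^sub>R gradU 0)"
      using norm_triangle_ineq[of "(x - \<gamma> *\<^sub>R gradU x) - (0 - \<gamma> *\<^sub>R gradU 0)" "0 - \<gamma> *\<^sub>R gradU 0"]
      by (simp add: a_def)
    then show ?thesis
      using gradient_step_contraction[OF \<gamma>_pos \<gamma>_le, of x 0] by (simp add: t_def)
  qed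
  also have "norm (\<gamma> *\<^sub>R gradU 0) = t * c"
    using \<gamma>_pos m_pos by (simp add: t_def c_def)
  finally have "a\<^sup>2 \<le> ((1 - t) * norm x + t * c)\<^sup>2"
    by (intro power_mono) (simp_all add: a_def)
  also have "\<dots> \<le> (1 - t) * (norm x)\<^sup>2 + t * c\<^sup>2"
  proof -
    have "(1 - t) * (norm x)\<^sup>2 + t * c\<^sup>2 - ((1 - t) * norm x + t * c)\<^sup>2 = t * (1 - t) * (norm x - c)\<^sup>2"
      by (simp add: power2_eq_square algebra_simps)
    moreover have "t * (1 - t) * (norm x - c)\<^sup>2 \<ge> 0"
      using t by simp
    ultimately show ?thesis by linarith
  qed
  finally have a2: "a\<^sup>2 \<le> (1 - t) * (norm x)\<^sup>2 + t * c\<^sup>2" .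
  have "(norm (proposal \<gamma> x z))\<^sup>2 \<le> (a + b)\<^sup>2"
    unfolding proposal_def using norm_triangle_ineq[of "x - \<gamma> *\<^sub>R gradU x" "sqrt (2 * \<gamma>) *\<^sub>R z"] \<gamma>_pos
    by (intro power_mono) (auto simp: a_def b_def)
  also have "\<dots> \<le> (1 + t) * a\<^sup>2 + (1 + 1 / t) * b\<^sup>2"
  proof -
    have "(1 + t) * a\<^sup>2 + (1 + 1 / t) * b\<^sup>2 - (a + b)\<^sup>2 = (t * a - b)\<^sup>2 / t"
      using t by (simp add: power2_eq_square field_simps)
    moreover have "(t * a - b)\<^sup>2 / t \<ge> 0"
      using t by simp
    ultimately show ?thesis by linarith
  qed
  also have "\<dots> \<le> (1 + t) * ((1 - t) * (norm x)\<^sup>2 + t * c\<^sup>2) + (1 + 1 / t) * b\<^sup>2"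
    using t by (intro add_right_mono mult_left_mono a2) auto
  also have "\<dots> = (1 - t\<^sup>2) * (norm x)\<^sup>2 + ((1 + t) * t * c\<^sup>2 + (1 + 1 / t) * b\<^sup>2)"
    by (simp add: power2_eq_square algebra_simps)
  also have "b\<^sup>2 = 2 * \<gamma> * (norm z)\<^sup>2"
    using \<gamma>_pos by (simp add: b_def power_mult_distrib)
  finally show ?thesis
    by (simp only: t_def c_def mult.assoc)
qed

lemma stationary_second_moment: "(\<integral>\<^sup>+x. ennreal ((norm x)\<^sup>2) \<partial>\<mu>) < \<infinity>"
proof -
  interpret G: prob_space "isotropic_gaussian 0 1 :: (real ^ 'n) measure"
    by (rule prob_space_isotropic_gaussian) simp
  let ?G = "isotropic_gaussian 0 1 :: (real ^ 'n) measure"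
  define b\<^sub>0 where "b\<^sub>0 = (1 + \<gamma> * m) * (\<gamma> * m) * (norm (gradU 0) / m)\<^sup>2"
  define b\<^sub>1 where "b\<^sub>1 = (1 + 1 / (\<gamma> * m)) * (2 * \<gamma>)"
  define b where "b = b\<^sub>0 + b\<^sub>1 * CARD('n)"
  define a where "a = (\<gamma> * m)\<^sup>2"
  have nonneg: "b\<^sub>0 \<ge> 0" "b\<^sub>1 \<ge> 0"
    using \<gamma>m \<gamma>_pos m_pos by (auto simp: b\<^sub>0_def b\<^sub>1_def)
  have a: "0 < a" "a \<le> 1"
    using \<gamma>m by (auto simp: a_def power_le_one)
  have proposal_moment: "(\<integral>\<^sup>+z. ennreal ((norm (proposal \<gamma> x z))\<^sup>2) \<partial>?G) \<le> ennreal ((1 - a) * (norm x)\<^sup>2 + b)" for x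
  proof -
    have r: "(1 - a) * (norm x)\<^sup>2 + b\<^sub>0 \<ge> 0"
      using a nonneg by simp
    have "(\<integral>\<^sup>+z. ennreal ((norm (proposal \<gamma> x z))\<^sup>2) \<partial>?G)
        \<le> (\<integral>\<^sup>+z. ennreal ((1 - a) * (norm x)\<^sup>2 + b\<^sub>0) + ennreal b\<^sub>1 * ennreal ((norm z)\<^sup>2) \<partial>?G)"
      using norm_proposal_le[of x] r nonneg
      by (intro nn_integral_mono)
         (simp add: a_def b\<^sub>0_def b\<^sub>1_def add.assoc ennreal_leI flip: ennreal_plus ennreal_mult)
    also have "\<dots> = ennreal ((1 - a) * (norm x)\<^sup>2 + b\<^sub>0) + ennreal b\<^sub>1 * ennreal (CARD('n))"
      using G.emeasure_space_1 isotropic_gaussian_second_moment[of 1, where 'n='n]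
      by (simp add: nn_integral_add nn_integral_cmult)
    also have "\<dots> = ennreal ((1 - a) * (norm x)\<^sup>2 + b)"
      using r nonneg by (simp add: b_def add.assoc flip: ennreal_plus ennreal_mult)
    finally show ?thesis .
  qed
  show ?thesis
  proof (rule second_moment_finite_if_drift[OF prob_space_\<mu> _ _ a])
    fix M :: real assume M: "M > 0"
    have "(\<integral>\<^sup>+x. ennreal (min ((norm x)\<^sup>2) M) \<partial>\<mu>)
        = (\<integral>\<^sup>+x. \<integral>\<^sup>+z. ennreal (min ((norm (proposal \<gamma> x z))\<^sup>2) M) \<partial>?G \<partial>\<mu>)"
      by (rule nn_integral_stationary[symmetric]) measurable
    also have "\<dots> \<le> (\<integral>\<^sup>+x. ennreal (min ((1 - a) * (norm x)\<^sup>2 + b) M) \<partial>\<mu>)"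
    proof (intro nn_integral_mono)
      fix x
      \<comment> \<open>Jensen's inequality for the concave truncation: the mean of a minimum is
        bounded by each of the two means.\<close>
      have "(\<integral>\<^sup>+z. ennreal (min ((norm (proposal \<gamma> x z))\<^sup>2) M) \<partial>?G) \<le> (\<integral>\<^sup>+z. ennreal M \<partial>?G)"
        by (intro nn_integral_mono ennreal_leI) simp
      moreover have "(\<integral>\<^sup>+z. ennreal (min ((norm (proposal \<gamma> x z))\<^sup>2) M) \<partial>?G)
          \<le> (\<integral>\<^sup>+z. ennreal ((norm (proposal \<gamma> x z))\<^sup>2) \<partial>?G)"
        by (intro nn_integral_mono ennreal_leI) simp
      ultimately show "(\<integral>\<^sup>+z. ennreal (min ((norm (proposal \<gamma> x z))\<^sup>2) M) \<partial>?G)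
          \<le> ennreal (min ((1 - a) * (norm x)\<^sup>2 + b) M)"
        using proposal_moment[of x] G.emeasure_space_1 by (auto simp: min_def intro: order_trans)
    qed
    finally show "(\<integral>\<^sup>+x. ennreal (min ((norm x)\<^sup>2) M) \<partial>\<mu>)
        \<le> (\<integral>\<^sup>+x. ennreal (min ((1 - a) * (norm x)\<^sup>2 + b) M) \<partial>\<mu>)" .
  qed (use nonneg in \<open>auto simp: b_def\<close>)
qed

section \<open>Couplings of the Gibbs measure with the stationary law\<close>

abbreviation transport_cost :: "((real ^ 'n) \<times> (real ^ 'n)) measure \<Rightarrow> ennreal" where
  "transport_cost \<zeta> \<equiv> (\<integral>\<^sup>+z. ennreal ((dist (fst z) (snd z))\<^sup>2) \<partial>\<zeta>)"

lemma couplings_iff: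
  "\<zeta> \<in> couplings (gibbs_measure U) \<mu> \<longleftrightarrow>
     sets \<zeta> = sets (borel \<Otimes>\<^sub>M borel) \<and> distr \<zeta> borel fst = gibbs_measure U \<and> distr \<zeta> borel snd = \<mu>"
  by (simp add: couplings_def)

text \<open>The product measure serves, as both marginals have second moments. Finiteness is what
  later permits subtracting the distance from both sides of the contraction inequality.\<close>

lemma finite_cost_coupling: "\<exists>\<zeta>\<in>couplings (gibbs_measure U) \<mu>. transport_cost \<zeta> < \<infinity>"
proof
  interpret \<mu>: prob_space \<mu>
    by (rule prob_space_\<mu>)
  interpret \<pi>: prob_space "gibbs_measure U"
    by (rule prob_space_gibbs)
  interpret P: pair_prob_space "gibbs_measure U" \<mu> ..
  let ?\<zeta> = "gibbs_measure U \<Otimes>\<^sub>M \<mu>"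
  have sets: "sets ?\<zeta> = sets (borel \<Otimes>\<^sub>M borel)"
    by (intro sets_pair_measure_cong) auto
  have "distr ?\<zeta> borel fst = gibbs_measure U"
    using \<mu>.distr_pair_fst[of "gibbs_measure U"] by (subst distr_cong[OF refl _ refl]) auto
  moreover have "distr ?\<zeta> borel snd = \<mu>"
  proof (rule measure_eqI)
    fix A assume "A \<in> sets (distr ?\<zeta> borel snd)"
    then have [measurable]: "A \<in> sets borel" by simp
    have "emeasure (distr ?\<zeta> borel snd) A = (\<integral>\<^sup>+z. indicator A (snd z) \<partial>?\<zeta>)"
      by (subst nn_integral_indicator[symmetric]) (simp_all add: nn_integral_distr del: nn_integral_indicator)
    also have "\<dots> = (\<integral>\<^sup>+x. \<integral>\<^sup>+y. indicator A y \<partial>\<mu> \<partial>gibbs_measure U)"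
      by (subst \<mu>.nn_integral_fst[symmetric]) simp_all
    also have "\<dots> = emeasure \<mu> A"
      using \<pi>.emeasure_space_1 by simp
    finally show "emeasure (distr ?\<zeta> borel snd) A = emeasure \<mu> A" .
  qed simp
  ultimately show "?\<zeta> \<in> couplings (gibbs_measure U) \<mu>"
    by (simp add: couplings_iff sets)
  have "(\<integral>\<^sup>+x. ennreal ((norm x)\<^sup>2) \<partial>gibbs_measure U) \<le> (\<integral>\<^sup>+x. ennreal ((1 + norm x) ^ 6) \<partial>gibbs_measure U)"
  proof (intro nn_integral_mono ennreal_leI)
    fix x :: "real ^ 'n"
    have "(norm x)\<^sup>2 \<le> (1 + norm x)\<^sup>2"
      by (intro power_mono) auto
    also have "\<dots> \<le> (1 + norm x) ^ 6"
      by (intro power_increasing) auto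
    finally show "(norm x)\<^sup>2 \<le> (1 + norm x) ^ 6" .
  qed
  then have \<pi>_moment: "(\<integral>\<^sup>+x. ennreal ((norm x)\<^sup>2) \<partial>gibbs_measure U) < \<infinity>"
    using gibbs_power6_moment by (rule order_le_less_trans)
  have "transport_cost ?\<zeta> \<le> (\<integral>\<^sup>+z. 2 * ennreal ((norm (fst z))\<^sup>2) + 2 * ennreal ((norm (snd z))\<^sup>2) \<partial>?\<zeta>)"
  proof (intro nn_integral_mono)
    fix z :: "(real ^ 'n) \<times> (real ^ 'n)"
    have "(dist (fst z) (snd z))\<^sup>2 \<le> (norm (fst z) + norm (snd z))\<^sup>2"
      by (intro power_mono) (auto simp: dist_norm norm_triangle_ineq4)
    also have "\<dots> \<le> 2 * (norm (fst z))\<^sup>2 + 2 * (norm (snd z))\<^sup>2"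
      using zero_le_power2[of "norm (fst z) - norm (snd z)"] by (simp add: power2_sum power2_diff)
    finally have "ennreal ((dist (fst z) (snd z))\<^sup>2) \<le> ennreal (2 * (norm (fst z))\<^sup>2 + 2 * (norm (snd z))\<^sup>2)"
      by (rule ennreal_leI)
    then show "ennreal ((dist (fst z) (snd z))\<^sup>2) \<le> 2 * ennreal ((norm (fst z))\<^sup>2) + 2 * ennreal ((norm (snd z))\<^sup>2)"
      by (simp add: ennreal_mult)
  qed
  also have "\<dots> = 2 * (\<integral>\<^sup>+x. ennreal ((norm x)\<^sup>2) \<partial>gibbs_measure U) + 2 * (\<integral>\<^sup>+x. ennreal ((norm x)\<^sup>2) \<partial>\<mu>)"
    using \<mu>.emeasure_space_1 \<pi>.emeasure_space_1
    by (simp add: \<mu>.nn_integral_fst[symmetric] nn_integral_add nn_integral_cmult)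
  also have "\<dots> < \<infinity>"
    using \<pi>_moment stationary_second_moment by (simp add: ennreal_mult_less_top)
  finally show "transport_cost ?\<zeta> < \<infinity>" .
qed

text \<open>\<open>N\<close> Metropolis steps of size \<open>h\<close> in the first component and one Euler step of size \<open>N h\<close>
  in the second map couplings of the two stationary measures to such couplings.\<close>
lemma coupling_step:
  assumes \<zeta>: "\<zeta> \<in> couplings (gibbs_measure U) \<mu>" and "N > 0" "h > 0" "h \<le> 1" and N: "real N * h = \<gamma>"
    and q: "q \<ge> 0" "transport_cost \<zeta> \<le> ennreal (q\<^sup>2)"
  defines "R \<equiv> sqrt (enn2real rejection_total * h * \<gamma> * exp \<gamma>)"
  shows "(INF \<zeta>\<in>couplings (gibbs_measure U) \<mu>. transport_cost \<zeta>) \<le> ennreal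
    (((1 - \<gamma> * m) * q + R + L * (\<gamma> * R + \<gamma>\<^sup>2 / 2 * sqrt (L * CARD('n)) + \<gamma> * sqrt (\<gamma> * CARD('n))))\<^sup>2)"
proof -
  have sets_\<zeta> [simp, measurable_cong]: "sets \<zeta> = sets (borel \<Otimes>\<^sub>M borel)"
    and fst_\<zeta>: "distr \<zeta> borel fst = gibbs_measure U" and snd_\<zeta>: "distr \<zeta> borel snd = \<mu>"
    using \<zeta> by (auto simp: couplings_iff)
  define Y where "Y \<sigma> = snd (fst \<sigma>) - \<gamma> *\<^sub>R gradU (snd (fst \<sigma>)) + sqrt (2 * h) *\<^sub>R fst (snd (snd \<sigma>))"
    for \<sigma> :: "(real ^ 'n) chain_state"
  have [measurable]: "Y \<in> borel_measurable state_space"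
    unfolding Y_def by measurable
  define \<eta> where "\<eta> = distr (chain h \<zeta> N) (borel \<Otimes>\<^sub>M borel) (\<lambda>\<sigma>. (fst (snd \<sigma>), Y \<sigma>))"
  have first: "distr \<eta> borel fst = gibbs_measure U"
  proof (rule measure_eqI)
    fix A assume "A \<in> sets (distr \<eta> borel fst)"
    then have A [measurable]: "A \<in> sets borel" by simp
    have "emeasure (distr \<eta> borel fst) A = (\<integral>\<^sup>+x. indicator A x \<partial>distr \<eta> borel fst)"
      by simp
    also have "\<dots> = (\<integral>\<^sup>+\<sigma>. indicator A (fst (snd \<sigma>)) \<partial>chain h \<zeta> N)"
      by (simp add: \<eta>_def nn_integral_distr del: nn_integral_indicator)
    also have "\<dots> = (\<integral>\<^sup>+x. indicator A x \<partial>gibbs_measure U)"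
      by (rule chain_current[OF sets_\<zeta> fst_\<zeta> assms(3,4)]) measurable
    finally show "emeasure (distr \<eta> borel fst) A = emeasure (gibbs_measure U) A"
      by simp
  qed (simp add: \<eta>_def)
  \<comment> \<open>The sum of \<open>N\<close> standard increments, scaled by
    \<open>sqrt (2 * h)\<close>, has variance \<open>2 * h * N = 2 * \<gamma>\<close> per
    coordinate, that of one Euler increment.\<close>
  have gaussian: "(\<integral>\<^sup>+s. \<phi> (y - \<gamma> *\<^sub>R gradU y + sqrt (2 * h) *\<^sub>R s) \<partial>noise_law N)
      = (\<integral>\<^sup>+z. \<phi> (proposal \<gamma> y z) \<partial>isotropic_gaussian 0 1)"
    if [measurable]: "\<phi> \<in> borel_measurable borel" for \<phi> :: "real ^ 'n \<Rightarrow> ennreal" and y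
  proof -
    let ?a = "y - \<gamma> *\<^sub>R gradU y"
    have "(\<integral>\<^sup>+s. \<phi> (?a + sqrt (2 * h) *\<^sub>R s) \<partial>noise_law N)
        = (\<integral>\<^sup>+x. \<phi> x \<partial>distr (isotropic_gaussian 0 (real N)) borel (\<lambda>s. ?a + sqrt (2 * h) *\<^sub>R s))"
      using assms(2) by (subst nn_integral_distr) (auto simp: noise_law_def)
    also have "\<dots> = (\<integral>\<^sup>+x. \<phi> x \<partial>isotropic_gaussian ?a (2 * \<gamma>))"
      using assms(2,3) N by (subst isotropic_gaussian_affine) (auto simp: mult_ac)
    also have "\<dots> = (\<integral>\<^sup>+x. \<phi> x \<partial>distr (isotropic_gaussian 0 1) borel (proposal \<gamma> y))"
      using euler_kernel_eq[OF \<gamma>_pos, of y] by (simp add: euler_kernel_def)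
    also have "\<dots> = (\<integral>\<^sup>+z. \<phi> (proposal \<gamma> y z) \<partial>isotropic_gaussian 0 1)"
      by (subst nn_integral_distr) (auto simp: proposal_def)
    finally show ?thesis .
  qed
  have second: "distr \<eta> borel snd = \<mu>"
  proof (rule measure_eqI)
    fix A assume "A \<in> sets (distr \<eta> borel snd)"
    then have A [measurable]: "A \<in> sets borel" by simp
    have "emeasure (distr \<eta> borel snd) A = (\<integral>\<^sup>+x. indicator A x \<partial>distr \<eta> borel snd)"
      by simp
    also have "\<dots> = (\<integral>\<^sup>+\<sigma>. indicator A (Y \<sigma>) \<partial>chain h \<zeta> N)"
      by (simp add: \<eta>_def nn_integral_distr del: nn_integral_indicator)
    also have "\<dots> = (\<integral>\<^sup>+y. \<integral>\<^sup>+s. indicator A (y - \<gamma> *\<^sub>R gradU y + sqrt (2 * h) *\<^sub>R s) \<partial>noise_law N \<partial>distr \<zeta> borel snd)"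
      unfolding Y_def by (rule chain_noise[OF sets_\<zeta> fst_\<zeta> assms(3,4)]) measurable
    also have "\<dots> = (\<integral>\<^sup>+y. \<integral>\<^sup>+z. indicator A (proposal \<gamma> y z) \<partial>isotropic_gaussian 0 1 \<partial>\<mu>)"
      unfolding snd_\<zeta> by (intro nn_integral_cong gaussian) measurable
    also have "\<dots> = (\<integral>\<^sup>+y. indicator A y \<partial>\<mu>)"
      by (rule nn_integral_stationary) measurable
    finally show "emeasure (distr \<eta> borel snd) A = emeasure \<mu> A"
      by simp
  qed (simp add: \<eta>_def)
  have "l2_bounded \<zeta> (\<lambda>p. fst p - snd p) q"
    using q by (simp add: l2_bounded_def dist_norm)
  then have "l2_bounded (chain h \<zeta> N) (\<lambda>\<sigma>. fst (snd \<sigma>) - Y \<sigma>)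
    ((1 - \<gamma> * m) * q + R + L * (\<gamma> * R + \<gamma>\<^sup>2 / 2 * sqrt (L * CARD('n)) + \<gamma> * sqrt (\<gamma> * CARD('n))))"
    unfolding Y_def R_def
    by (rule chain_euler_distance[OF sets_\<zeta> fst_\<zeta> assms(3,4) _ N[symmetric] \<gamma>_pos \<gamma>_le])
  moreover have "transport_cost \<eta> = (\<integral>\<^sup>+\<sigma>. ennreal ((norm (fst (snd \<sigma>) - Y \<sigma>))\<^sup>2) \<partial>chain h \<zeta> N)"
    by (simp add: \<eta>_def nn_integral_distr dist_norm)
  moreover have "\<eta> \<in> couplings (gibbs_measure U) \<mu>"
    using first second by (simp add: couplings_iff) (simp add: \<eta>_def)
  ultimately show ?thesis
    by (auto simp: l2_bounded_def intro: INF_lower2)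
qed

text \<open>The step size is \<gamma> / N with N tending to infinity. The infimum on the left does
  not depend on N, and on the right only the rejection error does, which tends to zero.\<close>

lemma optimal_cost_step:
  assumes "\<zeta> \<in> couplings (gibbs_measure U) \<mu>" "q \<ge> 0" "transport_cost \<zeta> \<le> ennreal (q\<^sup>2)"
  shows "(INF \<zeta>\<in>couplings (gibbs_measure U) \<mu>. transport_cost \<zeta>) \<le> ennreal
    (((1 - \<gamma> * m) * q + L * (\<gamma>\<^sup>2 / 2 * sqrt (L * CARD('n)) + \<gamma> * sqrt (\<gamma> * CARD('n))))\<^sup>2)"
proof -
  define R where "R N = sqrt (enn2real rejection_total * (\<gamma> / real N) * \<gamma> * exp \<gamma>)" for N :: nat
  define B where "B R = ennreal (((1 - \<gamma> * m) * q + R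
    + L * (\<gamma> * R + \<gamma>\<^sup>2 / 2 * sqrt (L * CARD('n)) + \<gamma> * sqrt (\<gamma> * CARD('n))))\<^sup>2)" for R
  have "(\<lambda>N. \<gamma> / real N) \<longlonglongrightarrow> 0"
    by (rule lim_const_over_n)
  then have "R \<longlonglongrightarrow> sqrt (enn2real rejection_total * 0 * \<gamma> * exp \<gamma>)"
    unfolding R_def by (intro tendsto_intros)
  then have "R \<longlonglongrightarrow> 0"
    by simp
  then have "(\<lambda>N. B (R N)) \<longlonglongrightarrow> B 0"
    unfolding B_def by (intro tendsto_intros)
  moreover have "\<forall>\<^sub>F N in sequentially. (INF \<zeta>\<in>couplings (gibbs_measure U) \<mu>. transport_cost \<zeta>) \<le> B (R N)"
  proof -
    \<comment> \<open>From this index on the step size is at most 1, as the rejection estimates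
      demand.\<close>
    obtain N\<^sub>0 :: nat where "\<gamma> \<le> real N\<^sub>0"
      using real_arch_simple by blast
    then have "(INF \<zeta>\<in>couplings (gibbs_measure U) \<mu>. transport_cost \<zeta>) \<le> B (R N)" if "N \<ge> max 1 N\<^sub>0" for N
      using that \<gamma>_pos unfolding B_def R_def
      by (intro coupling_step[where N=N, OF assms(1) _ _ _ _ assms(2,3)]) (auto simp: divide_le_eq)
    then show ?thesis
      unfolding eventually_sequentially by blast
  qed
  ultimately have "(INF \<zeta>\<in>couplings (gibbs_measure U) \<mu>. transport_cost \<zeta>) \<le> B 0"
    by (rule tendsto_lowerbound) simp
  then show ?thesis
    by (simp add: B_def)
qed

text \<open>Couplings of cost below \<open>D\<^sup>2 + e\<close> are used, so no minimiser has to
  exist. As \<open>e\<close> tends to zero, \<open>D \<le> (1 - \<gamma> * m) * D + c\<close>, and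
  since \<open>D\<close> is a real number this yields
  \<open>\<gamma> * m * D \<le> c\<close>.\<close>

theorem wasserstein2_gibbs_stationary:
  "(wasserstein2 (gibbs_measure U) \<mu>)\<^sup>2 \<le> ennreal
    ((L / m * (\<gamma> / 2 * sqrt (L * CARD('n)) + sqrt (\<gamma> * CARD('n))))\<^sup>2)"
proof -
  define I where "I = (INF \<zeta>\<in>couplings (gibbs_measure U) \<mu>. transport_cost \<zeta>)"
  define c where "c = L * (\<gamma>\<^sup>2 / 2 * sqrt (L * CARD('n)) + \<gamma> * sqrt (\<gamma> * CARD('n)))"
  define D where "D = sqrt (enn2real I)"
  have "I < \<infinity>"
    using finite_cost_coupling unfolding I_def by (auto simp: INF_less_iff)
  then have D: "D \<ge> 0" "I = ennreal (D\<^sup>2)"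
    by (auto simp: D_def)
  have c: "c \<ge> 0"
    using L_pos \<gamma>_pos by (simp add: c_def)
  have step: "D \<le> (1 - \<gamma> * m) * sqrt (D\<^sup>2 + e) + c" if e: "e > 0" for e
  proof -
    have "I < ennreal (D\<^sup>2 + e)"
      using e unfolding D(2) by (intro ennreal_lessI) (auto intro: add_nonneg_pos)
    then obtain \<zeta> where \<zeta>: "\<zeta> \<in> couplings (gibbs_measure U) \<mu>" "transport_cost \<zeta> < ennreal (D\<^sup>2 + e)"
      unfolding I_def INF_less_iff by blast
    then have "transport_cost \<zeta> \<le> ennreal ((sqrt (D\<^sup>2 + e))\<^sup>2)"
      using e by simp
    from optimal_cost_step[OF \<zeta>(1) _ this] have "ennreal (D\<^sup>2) \<le> ennreal (((1 - \<gamma> * m) * sqrt (D\<^sup>2 + e) + c)\<^sup>2)"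
      using e unfolding I_def[symmetric] c_def[symmetric] D(2)[symmetric] by simp
    then have "D\<^sup>2 \<le> ((1 - \<gamma> * m) * sqrt (D\<^sup>2 + e) + c)\<^sup>2"
      by (subst (asm) ennreal_le_iff) auto
    moreover have "(1 - \<gamma> * m) * sqrt (D\<^sup>2 + e) + c \<ge> 0"
      using c \<gamma>m(2) e by simp
    ultimately show ?thesis
      by (rule power2_le_imp_le)
  qed
  have "((\<lambda>e. (1 - \<gamma> * m) * sqrt (D\<^sup>2 + e) + c) \<longlongrightarrow> (1 - \<gamma> * m) * sqrt (D\<^sup>2 + 0) + c) (at_right 0)"
    by (intro tendsto_intros)
  moreover have "\<forall>\<^sub>F e in at_right 0. D \<le> (1 - \<gamma> * m) * sqrt (D\<^sup>2 + e) + c"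
    using step by (auto simp: eventually_at_filter)
  ultimately have "D \<le> (1 - \<gamma> * m) * sqrt (D\<^sup>2 + 0) + c"
    by (rule tendsto_lowerbound) simp
  then have "(\<gamma> * m) * D \<le> c"
    using D(1) by (simp add: algebra_simps)
  also have "c = (\<gamma> * m) * (L / m * (\<gamma> / 2 * sqrt (L * CARD('n)) + sqrt (\<gamma> * CARD('n))))"
    using m_pos by (simp add: c_def power2_eq_square algebra_simps)
  finally have "D \<le> L / m * (\<gamma> / 2 * sqrt (L * CARD('n)) + sqrt (\<gamma> * CARD('n)))"
    using \<gamma>m(1) by (simp only: mult_le_cancel_left_pos)
  then have "I \<le> ennreal ((L / m * (\<gamma> / 2 * sqrt (L * CARD('n)) + sqrt (\<gamma> * CARD('n))))\<^sup>2)"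
    unfolding D(2) using D(1) by (intro ennreal_leI power_mono)
  then show ?thesis
    by (simp add: wasserstein2_def ennreal_sqrt_power2 I_def)
qed

end

end

theorem corollary7:
  fixes U :: "real ^ 'n \<Rightarrow> real"
    and gradU :: "real ^ 'n \<Rightarrow> real ^ 'n"
    and L m \<gamma> \<kappa> d :: real
    and \<pi>\<^sub>\<gamma> :: "(real ^ 'n) measure"
  assumes "\<And>x. GDERIV U x :> gradU x"
    and "continuous_on UNIV gradU"
    and "L \<ge> 0" and "m > 0"
    and "\<And>x y. norm (gradU x - gradU y) \<le> L * norm (x - y)"
    and "\<And>x y. U y \<ge> U x + gradU x \<bullet> (y - x) + m / 2 * (norm (x - y))\<^sup>2"
    and "\<gamma> \<in> {0 <.. 1 / (m + L)}"
    and "\<kappa> = 2 * m * L / (m + L)"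
    and "d = real CARD('n)"
    and "stationary_distribution (euler_kernel gradU \<gamma>) \<pi>\<^sub>\<gamma>"
  shows "(wasserstein2 (gibbs_measure U) \<pi>\<^sub>\<gamma>)\<^sup>2 \<le>
    ennreal (2 * inverse \<kappa> * L\<^sup>2 * \<gamma> * (inverse \<kappa> + \<gamma>) *
             (2 * d + d * L\<^sup>2 * \<gamma> / m + d * L\<^sup>2 * \<gamma>\<^sup>2 / 6))"
proof -
  interpret strongly_convex_potential U gradU L m
    using assms by unfold_locales
  have \<gamma>: "\<gamma> > 0" "\<gamma> * (m + L) \<le> 1"
    using assms(7) L_pos m_pos by (auto simp: pos_le_divide_eq)
  have "(wasserstein2 (gibbs_measure U) \<pi>\<^sub>\<gamma>)\<^sup>2 \<le> ennreal
      ((L / m * (\<gamma> / 2 * sqrt (L * CARD('n)) + sqrt (\<gamma> * CARD('n))))\<^sup>2)"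
    by (rule wasserstein2_gibbs_stationary[OF assms(10) \<gamma>])
  also have "\<dots> \<le> ennreal (2 * inverse \<kappa> * L\<^sup>2 * \<gamma> * (inverse \<kappa> + \<gamma>) *
             (2 * d + d * L\<^sup>2 * \<gamma> / m + d * L\<^sup>2 * \<gamma>\<^sup>2 / 6))"
    unfolding assms(8,9) by (intro ennreal_leI wasserstein_bound_le m_pos L_pos \<gamma>) simp
  finally show ?thesis .
qed

end
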